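(* Let $\Gamma\subset \mathrm{SL}(2,\mathbb{R})$ be the discrete group of a Shimura curve $X=\Gamma\backslash\mathfrak{H}$ of genus zero, and let $\tau_1,\dots,\tau_r\in\mathfrak{H}$ be representatives of the elliptic points of $X$, of orders $e_1,\dots,e_r$ respectively. Let $t(\tau)$ be a Hauptmodul of $X$ and set $a_i=t(\tau_i)\in\mathbb{C}\cup\{\infty\}$, $i=1,\dots,r$. For an even integer $k\ge 4$, let $d_k=\dim S_k(\Gamma)$, which equals $$d_k = 1-k+\sum_{j=1}^r\left\lfloor \frac{k}{2}\left(1-\frac{1}{e_j}\right)\right\rfloor .$$ Then the functions $$t'(\tau)^{k/2}\, t(\tau)^j \prod_{1\le i\le r,\ a_i\neq\infty}\bigl(t(\tau)-a_i\bigr)^{-\lfloor k(1-1/e_i)/2\rfloor},\qquad j=0,\dots,d_k-1,$$ form a basis of $S_k(\Gamma)$.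
   Context: A Shimura curve here is $\Gamma\backslash\mathfrak{H}$ ($\mathfrak{H}$ the upper half-plane) where $\Gamma\subset\mathrm{SL}(2,\mathbb{R})$ is commensurable with $\iota(\mathcal{O}_1^* )$, the image of the norm-one units of an order $\mathcal{O}$ in a quaternion algebra $B\neq M(2,\mathbb{Q})$ over a totally real field which splits at exactly one infinite place, under an embedding $\iota:B\hookrightarrow M(2,\mathbb{R})$; such $\Gamma\backslash\mathfrak{H}$ is compact (no cusps). An elliptic point of order $e$ is a point of $\mathfrak{H}$ whose stabilizer in $\Gamma/\{\pm I\}$ has order $e\ge 2$. A Hauptmodul is a $\Gamma$-invariant meromorphic function $t$ on $\mathfrak{H}$ generating the function field of the genus-zero curve $\Gamma\backslash\mathfrak{H}$ (i.e. inducing an isomorphism onto $\mathbb{P}^1$); $t'(\tau)=dt/d\tau$. $S_k(\Gamma)$ is the space of automorphic forms of weight $k$: holomorphic $f:\mathfrak{H}\to\mathbb{C}$ with $f\bigl(\frac{a\tau+b}{c\tau+d}\bigr)=(c\tau+d)^kf(\tau)$ for all $\begin{pmatrix}a&b\\c&d\end{pmatrix}\in\Gamma$. *)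

theory Defs
  imports
    "HOL-Complex_Analysis.Complex_Analysis"
    "HOL-Algebra.QuotRing"
    "HOL-Algebra.Embedded_Algebras"
    "HOL-Library.Function_Algebras"
begin

unbundle no fps_syntax

definition ring_on :: "'a::ring_1 set \<Rightarrow> 'a ring" where
  "ring_on S = \<lparr>carrier = S, monoid.mult = (*), one = 1, ring.zero = 0, add = (+)\<rparr>"

definition mat2_ring :: "real set \<Rightarrow> (real^2^2) ring" where
  "mat2_ring S = \<lparr>carrier = {A. \<forall>i j. A $ i $ j \<in> S}, monoid.mult = (**), one = mat 1,
                  ring.zero = 0, add = (+)\<rparr>"

text \<open>A totally real number field is taken as a subfield of the reals, via one of its (real)
  embeddings; no relation is imposed between that embedding and the split place below.\<close>

definition totally_real_field :: "real set \<Rightarrow> bool" where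
  "totally_real_field F \<longleftrightarrow>
     subfield F (ring_on UNIV) \<and> ring.finite_dimension (ring_on UNIV) \<rat> F \<and>
     (\<forall>\<phi> \<in> ring_hom (ring_on F) (ring_on (UNIV :: complex set)). \<phi> ` F \<subseteq> \<real>)"

definition integers_of :: "real set \<Rightarrow> real set" where
  "integers_of F = {x \<in> F. algebraic_int x}"

text \<open>The quaternion algebra \<open>(a,b/F)\<close>: the tuple \<open>(x0,x1,x2,x3)\<close> stands for
  \<open>x0 + x1 i + x2 j + x3 ij\<close> with \<open>i\<^sup>2 = a\<close>, \<open>j\<^sup>2 = b\<close>, \<open>ij = -ji\<close>. For \<open>a, b \<noteq> 0\<close> these are, up to
  isomorphism, all quaternion algebras over \<open>F\<close>.\<close>

type_synonym quat = "real \<times> real \<times> real \<times> real"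

fun quat_mult :: "real \<Rightarrow> real \<Rightarrow> quat \<Rightarrow> quat \<Rightarrow> quat" where
  "quat_mult a b (x0, x1, x2, x3) (y0, y1, y2, y3) =
     (x0 * y0 + a * x1 * y1 + b * x2 * y2 - a * b * x3 * y3,
      x0 * y1 + x1 * y0 - b * x2 * y3 + b * x3 * y2,
      x0 * y2 + x2 * y0 + a * x1 * y3 - a * x3 * y1,
      x0 * y3 + x3 * y0 + x1 * y2 - x2 * y1)"

definition quat_ring :: "real set \<Rightarrow> real \<Rightarrow> real \<Rightarrow> quat ring" where
  "quat_ring F a b = \<lparr>carrier = F \<times> F \<times> F \<times> F, monoid.mult = quat_mult a b, one = (1, 0, 0, 0),
                      ring.zero = 0, add = (+)\<rparr>"

fun quat_norm :: "real \<Rightarrow> real \<Rightarrow> quat \<Rightarrow> real" where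
  "quat_norm a b (x0, x1, x2, x3) = x0\<^sup>2 - a * x1\<^sup>2 - b * x2\<^sup>2 + a * b * x3\<^sup>2"

text \<open>An infinite place of a totally real \<open>F\<close> is an embedding \<open>\<phi>\<close> of \<open>F\<close> into the reals
  (made unique as a HOL function by extensionality). The base change of \<open>(a,b/F)\<close> along \<open>\<phi>\<close> is
  \<open>(\<phi>(a),\<phi>(b)/\<real>)\<close>.\<close>

definition splits_at :: "real \<Rightarrow> real \<Rightarrow> (real \<Rightarrow> real) \<Rightarrow> bool" where
  "splits_at a b \<phi> \<longleftrightarrow> quat_ring UNIV (\<phi> a) (\<phi> b) \<simeq> mat2_ring UNIV"

definition splits_at_one_place :: "real set \<Rightarrow> real \<Rightarrow> real \<Rightarrow> bool" where
  "splits_at_one_place F a b \<longleftrightarrow>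
     (\<exists>!\<phi>. \<phi> \<in> extensional F \<and> \<phi> \<in> ring_hom (ring_on F) (ring_on UNIV) \<and> splits_at a b \<phi>)"

definition lin_combs :: "real set \<Rightarrow> quat set \<Rightarrow> quat set" where
  "lin_combs R S = {(\<Sum>s\<in>S. c s *\<^sub>R s) | c. c \<in> S \<rightarrow> R}"

definition quat_order :: "real set \<Rightarrow> real \<Rightarrow> real \<Rightarrow> quat set \<Rightarrow> bool" where
  "quat_order F a b \<O> \<longleftrightarrow>
     subring \<O> (quat_ring F a b) \<and>
     (\<exists>S. finite S \<and> \<O> = lin_combs (integers_of F) S \<and> carrier (quat_ring F a b) = lin_combs F S)"

definition norm_one_units :: "real set \<Rightarrow> real \<Rightarrow> real \<Rightarrow> quat set \<Rightarrow> quat set" where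
  "norm_one_units F a b \<O> =
     {x \<in> Units (quat_ring F a b \<lparr>carrier := \<O>\<rparr>). quat_norm a b x = 1}"

definition SL2R :: "(real^2^2) monoid" where
  "SL2R = \<lparr>carrier = {A. det A = 1}, monoid.mult = (**), one = mat 1\<rparr>"

definition commensurable :: "(real^2^2) set \<Rightarrow> (real^2^2) set \<Rightarrow> bool" where
  "commensurable G H \<longleftrightarrow>
     finite (rcosets\<^bsub>SL2R\<lparr>carrier := G\<rparr>\<^esub> (G \<inter> H)) \<and>
     finite (rcosets\<^bsub>SL2R\<lparr>carrier := H\<rparr>\<^esub> (G \<inter> H))"

definition shimura_group :: "(real^2^2) set \<Rightarrow> bool" where
  "shimura_group \<Gamma> \<longleftrightarrow>
     subgroup \<Gamma> SL2R \<and>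
     (\<exists>F a b \<O> \<iota>.
        totally_real_field F \<and> a \<in> F - {0} \<and> b \<in> F - {0} \<and>
        \<not> quat_ring F a b \<simeq> mat2_ring \<rat> \<and>
        splits_at_one_place F a b \<and>
        quat_order F a b \<O> \<and>
        \<iota> \<in> ring_hom (quat_ring F a b) (mat2_ring UNIV) \<and>
        inj_on \<iota> (carrier (quat_ring F a b)) \<and>
        commensurable \<Gamma> (\<iota> ` norm_one_units F a b \<O>))"

definition uhp :: "complex set" where
  "uhp = {z. Im z > 0}"

definition act :: "real^2^2 \<Rightarrow> complex \<Rightarrow> complex" where
  "act A = moebius (complex_of_real (A $ 1 $ 1)) (complex_of_real (A $ 1 $ 2))
                   (complex_of_real (A $ 2 $ 1)) (complex_of_real (A $ 2 $ 2))"

definition equivalent :: "(real^2^2) set \<Rightarrow> complex \<Rightarrow> complex \<Rightarrow> bool" where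
  "equivalent \<Gamma> z w \<longleftrightarrow> (\<exists>A\<in>\<Gamma>. w = act A z)"

text \<open>Order of the stabilizer in \<open>\<Gamma>/{\<plusminus>I}\<close>, meaning the image of \<open>\<Gamma>\<close> in \<open>PSL(2,\<real>)\<close> when
  \<open>-I \<notin> \<Gamma>\<close>.\<close>

definition stabilizer_order :: "(real^2^2) set \<Rightarrow> complex \<Rightarrow> nat" where
  "stabilizer_order \<Gamma> z = card ((\<lambda>A. {A, -A}) ` {A \<in> \<Gamma>. act A z = z})"

definition elliptic_point :: "(real^2^2) set \<Rightarrow> complex \<Rightarrow> bool" where
  "elliptic_point \<Gamma> z \<longleftrightarrow> z \<in> uhp \<and> stabilizer_order \<Gamma> z \<ge> 2"

definition elliptic_representatives ::
  "(real^2^2) set \<Rightarrow> nat \<Rightarrow> (nat \<Rightarrow> complex) \<Rightarrow> (nat \<Rightarrow> nat) \<Rightarrow> bool" where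
  "elliptic_representatives \<Gamma> r \<tau> e \<longleftrightarrow>
     (\<forall>i\<in>{1..r}. elliptic_point \<Gamma> (\<tau> i) \<and> e i = stabilizer_order \<Gamma> (\<tau> i)) \<and>
     (\<forall>z. elliptic_point \<Gamma> z \<longrightarrow> (\<exists>!i. i \<in> {1..r} \<and> equivalent \<Gamma> (\<tau> i) z))"

text \<open>\<open>q\<close> induces a homeomorphism from the quotient space of \<open>uhp\<close> by \<open>\<Gamma>\<close> onto \<open>Y\<close>.\<close>

definition induces_homeo ::
  "(real^2^2) set \<Rightarrow> 'b topology \<Rightarrow> (complex \<Rightarrow> 'b) \<Rightarrow> bool" where
  "induces_homeo \<Gamma> Y q \<longleftrightarrow>
     quotient_map (top_of_set uhp) Y q \<and>
     (\<forall>z\<in>uhp. \<forall>w\<in>uhp. q z = q w \<longleftrightarrow> equivalent \<Gamma> z w)"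

definition genus_zero :: "(real^2^2) set \<Rightarrow> bool" where
  "genus_zero \<Gamma> \<longleftrightarrow> (\<exists>q. induces_homeo \<Gamma> (top_of_set (sphere (0 :: real^3) 1)) q)"

text \<open>By \<^const>\<open>nicely_meromorphic_on\<close>, meromorphic functions take their limit as value away
  from the poles, and the dummy value \<open>0\<close> at the poles.\<close>

definition modular_functions :: "(real^2^2) set \<Rightarrow> (complex \<Rightarrow> complex) set" where
  "modular_functions \<Gamma> =
     {f. f nicely_meromorphic_on uhp \<and> (\<forall>A\<in>\<Gamma>. \<forall>z\<in>uhp. f (act A z) = f z)}"

text \<open>Values in \<open>\<complex> \<union> {\<infinity>}\<close>, with \<^const>\<open>None\<close> as \<open>\<infinity>\<close>; the topology of the Riemann sphere is
  then \<^const>\<open>Alexandroff_compactification\<close> of the plane.\<close>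

definition sphere_value :: "(complex \<Rightarrow> complex) \<Rightarrow> complex \<Rightarrow> complex option" where
  "sphere_value f z = (if is_pole f z then None else Some (f z))"

text \<open>The two final conjuncts say that \<open>t\<close> generates the function field, and that the (holomorphic)
  map it induces from the quotient to the Riemann sphere is bijective and a homeomorphism, hence
  an isomorphism of Riemann surfaces. For a genus-zero quotient either conjunct implies the other.\<close>

definition hauptmodul :: "(real^2^2) set \<Rightarrow> (complex \<Rightarrow> complex) \<Rightarrow> bool" where
  "hauptmodul \<Gamma> t \<longleftrightarrow>
     t \<in> modular_functions \<Gamma> \<and>
     (\<forall>f\<in>modular_functions \<Gamma>. \<exists>p q :: complex poly. q \<noteq> 0 \<and>
        (\<forall>\<^sub>\<approx>z\<in>uhp. f z = poly p (t z) / poly q (t z))) \<and>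
     induces_homeo \<Gamma> (Alexandroff_compactification euclidean) (sphere_value t)"

text \<open>Functions on the upper half-plane are represented by functions on \<open>\<complex>\<close> that vanish outside of
  it, so that they form a complex vector space under the pointwise operations.\<close>

definition forms :: "nat \<Rightarrow> (real^2^2) set \<Rightarrow> (complex \<Rightarrow> complex) set" where
  "forms k \<Gamma> =
     {f. f holomorphic_on uhp \<and>
         (\<forall>A\<in>\<Gamma>. \<forall>z\<in>uhp. f (act A z) =
            (complex_of_real (A $ 2 $ 1) * z + complex_of_real (A $ 2 $ 2)) ^ k * f z) \<and>
         (\<forall>z. z \<notin> uhp \<longrightarrow> f z = 0)}"

definition cscale :: "complex \<Rightarrow> (complex \<Rightarrow> complex) \<Rightarrow> complex \<Rightarrow> complex" where
  "cscale c f = (\<lambda>z. c * f z)"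

global_interpretation cfun: vector_space cscale
  by standard (auto simp: cscale_def fun_eq_iff algebra_simps)

text \<open>The function on the upper half-plane given by a meromorphic expression: the expression is
  replaced by its limit at removable singularities (here, in the zeros and poles of the
  factors).\<close>

definition on_uhp :: "(complex \<Rightarrow> complex) \<Rightarrow> complex \<Rightarrow> complex" where
  "on_uhp f = (\<lambda>z. if z \<in> uhp then remove_sings f z else 0)"

end

theory Submission
  imports Defs "HOL-Computational_Algebra.Fundamental_Theorem_Algebra"
begin

text \<open>
  Since \<open>t\<close> separates exactly the orbits of \<open>\<Gamma>\<close>, which is countable because the fibres of \<open>t\<close> are,
  the local rotations that permute the sheets of \<open>t\<close> at a point \<open>z\<close> come from \<open>\<Gamma>\<close>. Hence \<open>t\<close> has
  ramification index \<open>e\<^sub>i\<close> at the elliptic points of order \<open>e\<^sub>i\<close> and is unramified elsewhere.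
  If \<open>f\<close> has weight \<open>k = 2 m\<close>, then \<open>f / t'\<^sup>m\<close> is invariant, hence a rational function of \<open>t\<close>, and
  \<open>f\<close> is holomorphic if and only if the product of this rational function with
  \<open>\<Prod>(t - a\<^sub>i)\<close> to the powers \<open>\<lfloor>m (1 - 1/e\<^sub>i)\<rfloor>\<close> is a polynomial in \<open>t\<close> of degree at most
  \<open>\<Sum>\<lfloor>m (1 - 1/e\<^sub>i)\<rfloor> - 2 m\<close>. That this bound is at least \<open>-1\<close> follows from \<open>\<Sum>(1 - 1/e\<^sub>i) > 2\<close>, which
  expresses that a maximum principle excludes holomorphic forms of negative weight.
\<close>

(* Defs unbundles the homonymous syntax of formal Laurent series, so that the dollar sign for the
   entries of a matrix would still be ambiguous. *)
unbundle no Formal_Power_Series.fps_syntax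

subsection \<open>Orders of meromorphic functions\<close>

text \<open>Neither a valence formula nor a fundamental domain occurs. Surjectivity of
  \<open>sphere_value t\<close> replaces them: since every finite value is attained, local
  inequalities between orders become divisibility of polynomials, and a single point over infinity
  yields the bound on the degree. At a pole of t with stabilizer order n, t' has order -n-1, and
  -m(n+1) = m(n-1) - 2mn. After division by n this is the source of -2m; the rest is absorbed by the
  same floor as at a finite point. So the bound is the same whether or not infinity is an elliptic
  value, although the product skips that value. The obstacle is that the dimension formula is an
  equation of integers, which would fail if the right-hand side were negative. This forces an
  inequality on the signature; compactness of the sphere takes the place of an area formula. Orders
  are a relation, not a function: an instance contains the existence of the order, so products and
  quotients need no side conditions. Only a punctured neighbourhood matters, so the dummy value 0 of
  t at its poles does no harm.\<close>

definition has_order :: "(complex \<Rightarrow> complex) \<Rightarrow> complex \<Rightarrow> int \<Rightarrow> bool" where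
  "has_order f z n \<longleftrightarrow>
     (\<exists>g. g analytic_on {z} \<and> g z \<noteq> 0 \<and> (\<forall>\<^sub>F w in at z. f w = g w * (w - z) powi n))"

lemma has_orderI:
  assumes "g analytic_on {z}" "g z \<noteq> 0" "\<forall>\<^sub>F w in at z. f w = g w * (w - z) powi n"
  shows   "has_order f z n"
  using assms by (auto simp: has_order_def)

text \<open>An open set stays open when the point itself is removed. Hence an identity known off a
  singularity can be differentiated, or passed through \<open>remove_sings\<close>, at the nearby
  points.\<close>

lemma eventually_at_imp_eventually_nhds:
  fixes x :: "'a :: t1_space"
  assumes "eventually P (at x)"
  shows   "\<forall>\<^sub>F y in at x. eventually P (nhds y)"
proof -
  obtain S where S: "open S" "x \<in> S" "\<And>y. y \<in> S \<Longrightarrow> y \<noteq> x \<Longrightarrow> P y"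
    using assms by (auto simp: eventually_at_topological)
  have "\<forall>\<^sub>F y in at x. y \<in> S - {x}"
    using S by (intro eventually_at_in_open) auto
  thus ?thesis
  proof eventually_elim
    case (elim y)
    have "\<forall>\<^sub>F w in nhds y. w \<in> S - {x}"
      using S elim by (intro eventually_nhds_in_open) auto
    thus ?case
      by eventually_elim (use S in auto)
  qed
qed

lemma eventually_nhds_analytic_at:
  assumes "f analytic_on {z}"
  shows   "\<forall>\<^sub>F w in nhds z. f analytic_on {w}"
proof -
  obtain A where A: "open A" "z \<in> A" "f holomorphic_on A"
    using assms by (auto simp: analytic_at)
  have "\<forall>\<^sub>F w in nhds z. w \<in> A"
    using A by (intro eventually_nhds_in_open)
  thus ?thesis
    by eventually_elim (use A analytic_at in blast)
qed

lemma analytic_nonzero_eventually: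
  assumes "g analytic_on {z}" "g z \<noteq> (0::complex)"
  shows   "\<forall>\<^sub>F w in nhds z. g w \<noteq> 0 \<and> g analytic_on {w}"
proof -
  have "isCont g z"
    using assms(1) by (rule analytic_at_imp_isCont)
  hence "(g \<longlongrightarrow> g z) (nhds z)"
    by (simp add: isCont_def tendsto_at_iff_tendsto_nhds)
  from tendsto_imp_eventually_ne[OF this assms(2)] show ?thesis
    using eventually_nhds_analytic_at[OF assms(1)]
    by eventually_elim (auto)
qed

lemma has_order_cong:
  assumes "has_order f z n" "\<forall>\<^sub>F w in at z. f w = g w"
  shows   "has_order g z n"
proof -
  obtain h where h: "h analytic_on {z}" "h z \<noteq> 0" "\<forall>\<^sub>F w in at z. f w = h w * (w - z) powi n"
    using assms by (auto simp: has_order_def)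
  show ?thesis
    using h(3) assms(2) by (intro has_orderI[OF h(1,2)]) (auto elim: eventually_elim2)
qed

lemma has_order_mult:
  assumes "has_order f z m" "has_order g z n"
  shows   "has_order (\<lambda>w. f w * g w) z (m + n)"
proof -
  obtain f' where f: "f' analytic_on {z}" "f' z \<noteq> 0" "\<forall>\<^sub>F w in at z. f w = f' w * (w - z) powi m"
    using assms by (auto simp: has_order_def)
  obtain g' where g: "g' analytic_on {z}" "g' z \<noteq> 0" "\<forall>\<^sub>F w in at z. g w = g' w * (w - z) powi n"
    using assms by (auto simp: has_order_def)
  show ?thesis
  proof (rule has_orderI)
    show "(\<lambda>w. f' w * g' w) analytic_on {z}"
      using f g by (intro analytic_intros)
    show "\<forall>\<^sub>F w in at z. f w * g w = f' w * g' w * (w - z) powi (m + n)"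
      using f(3) g(3) eventually_neq_at_within[of z z]
      by eventually_elim (simp add: power_int_add)
  qed (use f g in auto)
qed

lemma has_order_inverse:
  assumes "has_order f z n"
  shows   "has_order (\<lambda>w. inverse (f w)) z (-n)"
proof -
  obtain g where g: "g analytic_on {z}" "g z \<noteq> 0" "\<forall>\<^sub>F w in at z. f w = g w * (w - z) powi n"
    using assms by (auto simp: has_order_def)
  show ?thesis
  proof (rule has_orderI)
    show "(\<lambda>w. inverse (g w)) analytic_on {z}"
      using g by (intro analytic_intros) auto
    show "\<forall>\<^sub>F w in at z. inverse (f w) = inverse (g w) * (w - z) powi (-n)"
      using g(3) by eventually_elim (simp add: power_int_minus)
  qed (use g in auto)
qed

lemma has_order_powi:
  assumes "has_order f z n"
  shows   "has_order (\<lambda>w. f w powi k) z (k * n)"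
proof -
  obtain g where g: "g analytic_on {z}" "g z \<noteq> 0" "\<forall>\<^sub>F w in at z. f w = g w * (w - z) powi n"
    using assms by (auto simp: has_order_def)
  show ?thesis
  proof (rule has_orderI)
    show "(\<lambda>w. g w powi k) analytic_on {z}"
      using g by (intro analytic_intros) auto
    show "\<forall>\<^sub>F w in at z. f w powi k = g w powi k * (w - z) powi (k * n)"
      using g(3)
      by eventually_elim (simp add: power_int_mult_distrib power_int_mult mult.commute[of k])
  qed (use g in auto)
qed

lemma has_order_power: "has_order f z n \<Longrightarrow> has_order (\<lambda>w. f w ^ k) z (int k * n)"
  using has_order_powi[of f z n "int k"] by simp

lemma has_order_divide:
  assumes "has_order f z m" "has_order g z n"
  shows   "has_order (\<lambda>w. f w / g w) z (m - n)"
  using has_order_mult[OF assms(1) has_order_inverse[OF assms(2)]] by (simp add: field_simps)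

lemma has_order_analytic: "g analytic_on {z} \<Longrightarrow> g z \<noteq> 0 \<Longrightarrow> has_order g z 0"
  by (rule has_orderI[of g]) auto

lemma has_order_const: "c \<noteq> 0 \<Longrightarrow> has_order (\<lambda>_. c) z 0"
  by (rule has_order_analytic) auto

lemma has_order_prod:
  assumes "\<And>i. i \<in> I \<Longrightarrow> has_order (f i) z (n i)"
  shows   "has_order (\<lambda>w. \<Prod>i\<in>I. f i w) z (\<Sum>i\<in>I. n i)"
  using assms
  by (induction I rule: infinite_finite_induct) (auto intro: has_order_const has_order_mult)

lemma has_order_nonzero:
  assumes "has_order f z n"
  shows   "\<forall>\<^sub>F w in at z. f w \<noteq> 0"
proof -
  obtain g where g: "g analytic_on {z}" "g z \<noteq> 0" "\<forall>\<^sub>F w in at z. f w = g w * (w - z) powi n"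
    using assms by (auto simp: has_order_def)
  have "\<forall>\<^sub>F w in at z. g w \<noteq> 0"
    using analytic_nonzero_eventually[OF g(1,2)] unfolding eventually_at_filter
    by eventually_elim auto
  thus ?thesis
    using g(3) eventually_neq_at_within[of z z] by eventually_elim auto
qed

lemma has_order_exists:
  assumes "f meromorphic_on {z}" "\<exists>\<^sub>F w in at z. f w \<noteq> 0"
  obtains n where "has_order f z n"
proof -
  have "isolated_singularity_at f z" "not_essential f z"
    using assms(1) by (auto simp: meromorphic_at_iff)
  from zorder_exist[OF this assms(2)] obtain r where r: "r > 0" "zor_poly f z z \<noteq> 0"
    "zor_poly f z holomorphic_on cball z r"
    "\<And>w. w \<in> cball z r - {z} \<Longrightarrow> f w = zor_poly f z w * (w - z) powi zorder f z"
    by blast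
  have "has_order f z (zorder f z)"
  proof (rule has_orderI[where g = "zor_poly f z"])
    have "zor_poly f z holomorphic_on ball z r"
      by (rule holomorphic_on_subset[OF r(3)]) auto
    thus "zor_poly f z analytic_on {z}"
      using r(1) by (simp add: holomorphic_on_imp_analytic_at)
    have "\<forall>\<^sub>F w in at z. w \<in> ball z r - {z}"
      using r(1) by (intro eventually_at_in_open) auto
    thus "\<forall>\<^sub>F w in at z. f w = zor_poly f z w * (w - z) powi zorder f z"
      by eventually_elim (use r(4) in auto)
  qed (fact r(2))
  thus ?thesis using that by blast
qed

lemma has_order_nonneg_extension:
  assumes "has_order f z n" "n \<ge> 0"
  obtains h where "h analytic_on {z}" "\<forall>\<^sub>F w in at z. f w = h w" "h z = 0 \<longleftrightarrow> n > 0"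
proof -
  obtain g where g: "g analytic_on {z}" "g z \<noteq> 0" "\<forall>\<^sub>F w in at z. f w = g w * (w - z) powi n"
    using assms by (auto simp: has_order_def)
  show ?thesis
  proof (rule that[of "\<lambda>w. g w * (w - z) ^ nat n"])
    show "(\<lambda>w. g w * (w - z) ^ nat n) analytic_on {z}"
      using g by (intro analytic_intros)
    show "\<forall>\<^sub>F w in at z. f w = g w * (w - z) ^ nat n"
      using g(3) assms(2) by (simp add: power_int_def)
  qed (use g assms(2) in auto)
qed

text \<open>With two different orders, f/f would have a positive one and would extend by the value
  0, although it is 1 nearby.\<close>

lemma has_order_unique:
  assumes "has_order f z m" "has_order f z n"
  shows   "m = n"
proof -
  have *: "\<not> m < n" if "has_order f z m" "has_order f z n" for m n
  proof
    assume "m < n"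
    have "has_order (\<lambda>w. f w / f w) z (n - m)"
      using has_order_divide[OF that(2,1)] .
    moreover have "\<forall>\<^sub>F w in at z. f w / f w = 1"
      using has_order_nonzero[OF that(1)] by eventually_elim auto
    ultimately have "has_order (\<lambda>_. 1) z (n - m)"
      by (rule has_order_cong)
    then obtain h where h: "h analytic_on {z}" "\<forall>\<^sub>F w in at z. 1 = h w" "h z = 0"
      using \<open>m < n\<close> by (elim has_order_nonneg_extension) auto
    have "h \<midarrow>z\<rightarrow> 0"
      using h analytic_at_imp_isCont[OF h(1)] by (simp add: isCont_def)
    moreover have "h \<midarrow>z\<rightarrow> 1"
      using h(2) by (intro tendsto_eventually) (auto elim: eventually_mono)
    ultimately show False
      using LIM_unique by fastforce
  qed
  show ?thesis using *[of m n] *[of n m] assms by auto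
qed

section \<open>Extension across removable singularities, poles and derivatives\<close>

lemma remove_sings_eq_extension:
  assumes "h analytic_on {z}" "\<forall>\<^sub>F w in at z. f w = h w"
  shows   "remove_sings f z = h z"
  using remove_sings_cong[OF assms(2) refl] assms(1) by simp

lemma eventually_remove_sings_eq_extension:
  assumes "h analytic_on {z}" "\<forall>\<^sub>F w in at z. f w = h w"
  shows   "\<forall>\<^sub>F w in nhds z. remove_sings f w = h w"
proof -
  have "\<forall>\<^sub>F w in at z. \<forall>\<^sub>F x in nhds w. f x = h x"
    using assms(2) by (rule eventually_at_imp_eventually_nhds)
  moreover have "\<forall>\<^sub>F w in at z. h analytic_on {w}"
    using eventually_nhds_analytic_at[OF assms(1)] unfolding eventually_at_filter
    by eventually_elim auto
  ultimately have "\<forall>\<^sub>F w in at z. remove_sings f w = h w"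
    by eventually_elim (rule remove_sings_eq_extension, simp_all add: eventually_nhds_conv_at)
  thus ?thesis
    using remove_sings_eq_extension[OF assms] by (simp add: eventually_nhds_conv_at)
qed

lemma analytic_eq_of_eventually_eq:
  assumes "f analytic_on {z}" "g analytic_on {z}" "\<forall>\<^sub>F w in at z. f w = g w"
  shows   "f z = g z"
  using remove_sings_eq_extension[OF assms(2,3)] assms(1) by simp

lemma has_order_nonneg_remove_sings:
  assumes "has_order f z n" "n \<ge> 0"
  shows   "remove_sings f analytic_on {z}" "remove_sings f z = 0 \<longleftrightarrow> n > 0"
    and   "\<forall>\<^sub>F w in at z. f w = remove_sings f w"
proof -
  obtain h where h: "h analytic_on {z}" "\<forall>\<^sub>F w in at z. f w = h w" "h z = 0 \<longleftrightarrow> n > 0"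
    using has_order_nonneg_extension[OF assms] .
  note ev = eventually_remove_sings_eq_extension[OF h(1,2)]
  show "remove_sings f analytic_on {z}"
    using h(1) analytic_at_cong[OF ev refl] by simp
  show "remove_sings f z = 0 \<longleftrightarrow> n > 0"
    using remove_sings_eq_extension[OF h(1,2)] h(3) by simp
  have "\<forall>\<^sub>F w in at z. remove_sings f w = h w"
    using ev by (simp add: eventually_nhds_conv_at)
  thus "\<forall>\<^sub>F w in at z. f w = remove_sings f w"
    using h(2) by eventually_elim simp
qed

text \<open>A negative order lets 1/f extend analytically by the value 0, and then f itself tends to
  infinity.\<close>

lemma has_order_not_pole_imp_nonneg:
  assumes "has_order f z n" "\<not> is_pole f z"
  shows   "n \<ge> 0"
proof (rule ccontr)
  assume n: "\<not> n \<ge> 0"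
  have "has_order (\<lambda>w. inverse (f w)) z (-n)"
    by (rule has_order_inverse) fact
  then obtain h where h: "h analytic_on {z}" "\<forall>\<^sub>F w in at z. inverse (f w) = h w" "h z = 0"
    using n by (elim has_order_nonneg_extension) auto
  have "h \<midarrow>z\<rightarrow> 0"
    using h analytic_at_imp_isCont[OF h(1)] by (simp add: isCont_def)
  moreover have ev: "\<forall>\<^sub>F w in at z. h w \<noteq> 0 \<and> inverse (h w) = f w"
    using h(2) has_order_nonzero[OF assms(1)] by eventually_elim (metis inverse_inverse_eq inverse_nonzero_iff_nonzero)
  ultimately have "filterlim h (at 0) (at z)"
    by (auto simp: filterlim_at elim: eventually_mono)
  hence "filterlim (\<lambda>w. inverse (h w)) at_infinity (at z)"
    by (rule filterlim_compose[OF filterlim_inverse_at_infinity])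
  hence "is_pole f z"
    unfolding is_pole_def
    by (rule filterlim_mono_eventually) (use ev in \<open>auto elim: eventually_mono\<close>)
  thus False using assms by simp
qed

lemma has_order_pole_imp_neg:
  assumes "has_order f z n" "is_pole f z"
  shows   "n < 0"
proof (rule ccontr)
  assume "\<not> n < 0"
  then obtain h where h: "h analytic_on {z}" "\<forall>\<^sub>F w in at z. f w = h w"
    using assms(1) by (elim has_order_nonneg_extension) auto
  have "is_pole h z"
    using assms(2) is_pole_cong[OF h(2) refl] by simp
  thus False using h(1) analytic_at_imp_no_pole by blast
qed

lemma has_order_analytic_zero_imp_pos:
  assumes "has_order f z n" "f analytic_on {z}" "f z = 0"
  shows   "n > 0"
proof -
  have "n \<ge> 0"
    using assms analytic_at_imp_no_pole has_order_not_pole_imp_nonneg by blast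
  with has_order_nonneg_remove_sings(2)[OF assms(1)] assms(2,3) show ?thesis by simp
qed

text \<open>The cofactor of the derivative has the value n * g(z) at z, which is nonzero because n
  \<noteq> 0. The order drops by one at poles as well as at zeros.\<close>

lemma has_order_deriv:
  assumes "has_order f z n" "n \<noteq> 0"
  shows   "has_order (deriv f) z (n - 1)"
proof -
  obtain g where g: "g analytic_on {z}" "g z \<noteq> 0" "\<forall>\<^sub>F w in at z. f w = g w * (w - z) powi n"
    using assms by (auto simp: has_order_def)
  show ?thesis
  proof (rule has_orderI[of "\<lambda>w. deriv g w * (w - z) + of_int n * g w"])
    show "(\<lambda>w. deriv g w * (w - z) + of_int n * g w) analytic_on {z}"
      using g(1) by (intro analytic_intros)
    have "\<forall>\<^sub>F w in at z. \<forall>\<^sub>F x in nhds w. f x = g x * (x - z) powi n"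
      using g(3) by (rule eventually_at_imp_eventually_nhds)
    moreover have "\<forall>\<^sub>F w in at z. g analytic_on {w}"
      using eventually_nhds_analytic_at[OF g(1)] unfolding eventually_at_filter
      by eventually_elim auto
    ultimately show "\<forall>\<^sub>F w in at z. deriv f w =
        (deriv g w * (w - z) + of_int n * g w) * (w - z) powi (n - 1)"
      using g(3) eventually_neq_at_within[of z z]
    proof eventually_elim
      case (elim w)
      have "deriv f w = deriv (\<lambda>x. g x * (x - z) powi n) w"
        using elim(1) by (intro deriv_cong_ev) auto
      also have "\<dots> = (deriv g w * (w - z) + of_int n * g w) * (w - z) powi (n - 1)"
      proof (rule DERIV_imp_deriv)
        have "(g has_field_derivative deriv g w) (at w)"
          using elim(2) analytic_on_imp_differentiable_at DERIV_deriv_iff_field_differentiable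
          by blast
        thus "((\<lambda>x. g x * (x - z) powi n) has_field_derivative
            (deriv g w * (w - z) + of_int n * g w) * (w - z) powi (n - 1)) (at w)"
          using elim(4) elim(3)
          by (auto intro!: derivative_eq_intros simp: power_int_diff field_simps)
      qed
      finally show ?case .
    qed
  qed (use g assms(2) in auto)
qed

subsection \<open>The action on the upper half-plane\<close>

lemma open_uhp: "open uhp"
  unfolding uhp_def by (rule open_halfspace_Im_gt)

lemma convex_uhp: "convex uhp"
  unfolding uhp_def by (rule convex_halfspace_Im_gt)

lemma connected_uhp: "connected uhp"
  by (rule convex_connected) (rule convex_uhp)

lemma i_in_uhp: "\<i> \<in> uhp"
  by (simp add: uhp_def)

lemma eventually_in_uhp: "z \<in> uhp \<Longrightarrow> \<forall>\<^sub>F w in nhds z. w \<in> uhp"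
  using eventually_nhds_in_open open_uhp by blast

text \<open>The cocycle cz + d; its inverse square is the derivative of the action.\<close>

definition automorphy_factor :: "real^2^2 \<Rightarrow> complex \<Rightarrow> complex" where
  "automorphy_factor A z = complex_of_real (A $ 2 $ 1) * z + complex_of_real (A $ 2 $ 2)"

lemma act_conv_factor:
  "act A z = (complex_of_real (A $ 1 $ 1) * z + complex_of_real (A $ 1 $ 2)) / automorphy_factor A z"
  by (simp add: act_def moebius_def automorphy_factor_def)

lemma automorphy_factor_nonzero:
  assumes "det A = 1" "z \<in> uhp"
  shows   "automorphy_factor A z \<noteq> 0"
proof
  assume *: "automorphy_factor A z = 0"
  hence "A $ 2 $ 1 * Im z = 0"
    by (simp add: automorphy_factor_def complex_eq_iff)
  hence "A $ 2 $ 1 = 0"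
    using assms(2) by (simp add: uhp_def)
  moreover from this and * have "A $ 2 $ 2 = 0"
    by (simp add: automorphy_factor_def)
  ultimately show False
    using assms(1) by (simp add: det_2)
qed

lemma det_of_real:
  fixes A :: "real^2^2"
  assumes "det A = 1"
  shows   "complex_of_real (A $ 1 $ 1) * complex_of_real (A $ 2 $ 2) =
             1 + complex_of_real (A $ 1 $ 2) * complex_of_real (A $ 2 $ 1)"
proof -
  have "A $ 1 $ 1 * A $ 2 $ 2 = 1 + A $ 1 $ 2 * A $ 2 $ 1"
    using assms unfolding det_2 by linarith
  hence "complex_of_real (A $ 1 $ 1 * A $ 2 $ 2) = complex_of_real (1 + A $ 1 $ 2 * A $ 2 $ 1)"
    by (rule arg_cong)
  thus ?thesis
    by simp
qed

text \<open>The exact difference quotient of a Moebius map of determinant 1. It serves for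
  injectivity near a point, for powers of w - z under substitution, and for the factors at fixed
  points.\<close>

lemma act_diff:
  assumes "det A = 1" "z \<in> uhp" "w \<in> uhp"
  shows   "act A z - act A w = (z - w) / (automorphy_factor A z * automorphy_factor A w)"
proof -
  define a b c d where "a = complex_of_real (A $ 1 $ 1)" and "b = complex_of_real (A $ 1 $ 2)"
    and "c = complex_of_real (A $ 2 $ 1)" and "d = complex_of_real (A $ 2 $ 2)"
  have ad: "a * d = 1 + b * c"
    using det_of_real[OF assms(1)] by (simp add: a_def b_def c_def d_def)
  have nz: "automorphy_factor A z \<noteq> 0" "automorphy_factor A w \<noteq> 0"
    using automorphy_factor_nonzero assms by auto
  have "(a * z + b) * (c * w + d) - (a * w + b) * (c * z + d) = (a * d - b * c) * (z - w)"
    by (simp add: algebra_simps)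
  also have "\<dots> = z - w"
    using ad by simp
  finally show ?thesis
    using nz unfolding act_conv_factor
    by (simp add: field_simps a_def b_def c_def d_def automorphy_factor_def)
qed

lemma Im_act:
  assumes "det A = 1" "z \<in> uhp"
  shows   "Im (act A z) = Im z / cmod (automorphy_factor A z) ^ 2"
proof -
  define a b c d where "a = A $ 1 $ 1" and "b = A $ 1 $ 2" and "c = A $ 2 $ 1" and "d = A $ 2 $ 2"
  have ad: "a * d = 1 + b * c"
    using assms(1) unfolding det_2 a_def b_def c_def d_def by linarith
  have "Im (act A z) = ((a * Im z) * (c * Re z + d) - (a * Re z + b) * (c * Im z)) /
                         cmod (automorphy_factor A z) ^ 2"
    unfolding act_conv_factor
    by (simp add: Im_divide cmod_power2 automorphy_factor_def a_def b_def c_def d_def)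
  also have "(a * Im z) * (c * Re z + d) - (a * Re z + b) * (c * Im z) = (a * d - b * c) * Im z"
    by (simp add: algebra_simps)
  finally show ?thesis
    using ad by simp
qed

lemma act_in_uhp: "det A = 1 \<Longrightarrow> z \<in> uhp \<Longrightarrow> act A z \<in> uhp"
  using Im_act[of A z] automorphy_factor_nonzero[of A z] by (auto simp: uhp_def)

lemma act_mult:
  assumes "det A = 1" "det B = 1" "z \<in> uhp"
  shows   "act (A ** B) z = act A (act B z)"
proof -
  have nz: "automorphy_factor B z \<noteq> 0" "automorphy_factor A (act B z) \<noteq> 0"
    using automorphy_factor_nonzero act_in_uhp assms by auto
  define a b c d where "a = complex_of_real (B $ 1 $ 1)" and "b = complex_of_real (B $ 1 $ 2)"
    and "c = complex_of_real (B $ 2 $ 1)" and "d = complex_of_real (B $ 2 $ 2)"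
  define a' b' c' d' where "a' = complex_of_real (A $ 1 $ 1)" and "b' = complex_of_real (A $ 1 $ 2)"
    and "c' = complex_of_real (A $ 2 $ 1)" and "d' = complex_of_real (A $ 2 $ 2)"
  have B: "act B z = (a * z + b) / (c * z + d)" and j: "c * z + d \<noteq> 0"
    using nz by (simp_all add: act_conv_factor automorphy_factor_def a_def b_def c_def d_def)
  have *: "x * ((a * z + b) / (c * z + d)) + y = (x * (a * z + b) + y * (c * z + d)) / (c * z + d)" for x y
    using j by (simp add: field_simps)
  have "act A (act B z) = (a' * (a * z + b) + b' * (c * z + d)) / (c' * (a * z + b) + d' * (c * z + d))"
    unfolding act_conv_factor[of A] automorphy_factor_def B
    unfolding a'_def[symmetric] b'_def[symmetric] c'_def[symmetric] d'_def[symmetric] *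
    using j by simp
  also have "\<dots> = act (A ** B) z"
    by (simp add: act_conv_factor automorphy_factor_def matrix_matrix_mult_def sum_2
          a_def b_def c_def d_def a'_def b'_def c'_def d'_def algebra_simps)
  finally show ?thesis ..
qed

lemma act_mat_1 [simp]: "act (mat 1) z = z"
  by (simp add: act_conv_factor automorphy_factor_def mat_def)

lemma act_uminus: "act (- A) z = act A z"
proof -
  have "act (- A) z = - (complex_of_real (A $ 1 $ 1) * z + complex_of_real (A $ 1 $ 2)) /
          - automorphy_factor A z"
    unfolding act_conv_factor automorphy_factor_def by (rule arg_cong2[of _ _ _ _ "(/)"]) simp_all
  also have "\<dots> = act A z"
    unfolding act_conv_factor by (rule minus_divide_divide)
  finally show ?thesis .
qed

lemma has_field_derivative_act:
  assumes "det A = 1" "z \<in> uhp"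
  shows   "(act A has_field_derivative 1 / automorphy_factor A z ^ 2) (at z)"
proof -
  define a b c d where "a = complex_of_real (A $ 1 $ 1)" and "b = complex_of_real (A $ 1 $ 2)"
    and "c = complex_of_real (A $ 2 $ 1)" and "d = complex_of_real (A $ 2 $ 2)"
  have ad: "a * d = 1 + b * c"
    using det_of_real[OF assms(1)] by (simp add: a_def b_def c_def d_def)
  have nz: "c * z + d \<noteq> 0"
    using automorphy_factor_nonzero[OF assms] by (simp add: automorphy_factor_def c_def d_def)
  have "((\<lambda>z. (a * z + b) / (c * z + d)) has_field_derivative
          ((a * (c * z + d) - (a * z + b) * c) / ((c * z + d) * (c * z + d)))) (at z)"
    using nz by (auto intro!: derivative_eq_intros)
  also have "a * (c * z + d) - (a * z + b) * c = a * d - b * c"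
    by (simp add: algebra_simps)
  also have "\<dots> = 1"
    using ad by simp
  also have "(\<lambda>z. (a * z + b) / (c * z + d)) = act A"
    by (rule ext) (simp add: act_conv_factor automorphy_factor_def a_def b_def c_def d_def)
  finally show ?thesis
    by (simp add: automorphy_factor_def c_def d_def power2_eq_square)
qed

lemma holomorphic_act: "det A = 1 \<Longrightarrow> act A holomorphic_on uhp"
  by (rule holomorphic_onI)
     (auto simp: field_differentiable_def intro: has_field_derivative_act has_field_derivative_at_within)

lemma analytic_act: "det A = 1 \<Longrightarrow> act A analytic_on uhp"
  using holomorphic_act open_uhp by (simp add: analytic_on_open)

lemma isCont_act: "det A = 1 \<Longrightarrow> z \<in> uhp \<Longrightarrow> isCont (act A) z"
  using has_field_derivative_act DERIV_isCont by blast

lemma analytic_automorphy_factor: "automorphy_factor A analytic_on S"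
  unfolding automorphy_factor_def by (intro analytic_intros)

lemma filterlim_act:
  assumes "det A = 1" "z \<in> uhp"
  shows   "filterlim (act A) (at (act A z)) (at z)"
proof -
  have "act A \<midarrow>z\<rightarrow> act A z"
    using isCont_act[OF assms] by (simp add: isCont_def)
  moreover have "\<forall>\<^sub>F w in at z. act A w \<noteq> act A z"
  proof -
    have "\<forall>\<^sub>F w in at z. w \<in> uhp"
      using eventually_in_uhp[OF assms(2)] by (simp add: eventually_nhds_conv_at)
    thus ?thesis
      using eventually_neq_at_within[of z z]
    proof eventually_elim
      case (elim w)
      thus ?case
        using act_diff[OF assms(1) elim(1) assms(2)] automorphy_factor_nonzero[of A] assms
        by (auto simp: divide_eq_0_iff)
    qed
  qed
  ultimately show ?thesis
    by (simp add: filterlim_at)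
qed

lemma eventually_at_act:
  assumes "det A = 1" "z \<in> uhp" "eventually P (at (act A z))"
  shows   "\<forall>\<^sub>F w in at z. P (act A w)"
  using assms(3) filterlim_act[OF assms(1,2)] by (rule eventually_compose_filterlim)

text \<open>As z is not real, 1 and z are linearly independent over the reals: the value of cz + d
  determines c and d, and then the value of az + b determines a and b. Only the square of the factor
  is given, whence the sign.\<close>

lemma eq_or_eq_uminus:
  assumes "det A = 1" "det B = 1" "z \<in> uhp"
    and "act A z = act B z" "automorphy_factor A z ^ 2 = automorphy_factor B z ^ 2"
  shows   "A = B \<or> A = - B"
proof -
  have *: "A = B" if "det A = 1" "det B = 1" "act A z = act B z"
    "automorphy_factor A z = automorphy_factor B z" for A B :: "real^2^2"
  proof -
    have nz: "automorphy_factor A z \<noteq> 0" "automorphy_factor B z \<noteq> 0"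
      using automorphy_factor_nonzero that assms(3) by auto
    have Imz: "Im z > 0" using assms(3) by (simp add: uhp_def)
    have lin: "x = x' \<and> y = y'"
      if "complex_of_real x * z + complex_of_real y = complex_of_real x' * z + complex_of_real y'"
      for x y x' y'
    proof -
      have "x * Im z = x' * Im z" and r: "x * Re z + y = x' * Re z + y'"
        using that by (simp_all add: complex_eq_iff)
      hence "x = x'" using Imz by simp
      thus ?thesis using r by simp
    qed
    have 1: "A $ 2 $ 1 = B $ 2 $ 1 \<and> A $ 2 $ 2 = B $ 2 $ 2"
      using that(4) by (intro lin) (simp add: automorphy_factor_def)
    have 2: "A $ 1 $ 1 = B $ 1 $ 1 \<and> A $ 1 $ 2 = B $ 1 $ 2"
      using that(3) nz by (intro lin) (simp add: act_conv_factor that(4))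
    show ?thesis
      using 1 2 by (simp add: vec_eq_iff forall_2)
  qed
  have "automorphy_factor A z = automorphy_factor B z \<or>
        automorphy_factor A z = automorphy_factor (- B) z"
    using assms(5) by (simp add: power2_eq_iff automorphy_factor_def)
  moreover have "det (- B) = 1"
    using assms(2) by (simp add: det_2)
  moreover have "act A z = act (- B) z"
    by (simp add: act_uminus assms(4))
  ultimately show ?thesis
    using *[of A B] *[of A "- B"] assms by blast
qed

text \<open>The factors at the two fixed points have product 1 by \<open>act_diff\<close>, and the
  one at z has modulus 1 by \<open>Im_act\<close>, so they are conjugate. Comparing imaginary parts
  gives c (Im z + Im w) = 0, hence c = 0 and d = \<plusminus>1.\<close>

lemma act_two_fixed_points:
  assumes "det A = 1" "z \<in> uhp" "w \<in> uhp" "z \<noteq> w" "act A z = z" "act A w = w"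
  shows   "A = mat 1 \<or> A = - mat 1"
proof -
  define jz jw where "jz = automorphy_factor A z" "jw = automorphy_factor A w"
  have nz: "jz \<noteq> 0" "jw \<noteq> 0"
    using automorphy_factor_nonzero assms by (auto simp: jz_jw_def)
  have "(z - w) = (z - w) / (jz * jw)"
    using act_diff[OF assms(1-3)] assms(5,6) by (simp add: jz_jw_def)
  hence "jz * jw = 1"
    using nz assms(4) divide_cancel_left[of "z - w" "jz * jw" 1] by simp
  have "Im z = Im z / cmod jz ^ 2"
    using Im_act[OF assms(1,2)] assms(5) by (simp add: jz_jw_def)
  hence "cmod jz ^ 2 = 1"
    using assms(2) nz by (simp add: uhp_def field_simps)
  hence "jw = cnj jz"
    using \<open>jz * jw = 1\<close> nz
    by (metis complex_norm_square mult_left_cancel of_real_1)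
  hence "Im jw = - Im jz" by simp
  hence "A $ 2 $ 1 * (Im z + Im w) = 0"
    by (simp add: jz_jw_def automorphy_factor_def algebra_simps)
  hence c: "A $ 2 $ 1 = 0"
    using assms(2,3) by (auto simp: uhp_def)
  hence "jz = jw" by (simp add: jz_jw_def automorphy_factor_def)
  hence "jz ^ 2 = 1"
    using \<open>jz * jw = 1\<close> by (simp add: power2_eq_square)
  hence "automorphy_factor A z ^ 2 = automorphy_factor (mat 1) z ^ 2"
    by (simp add: jz_jw_def(1)) (simp add: automorphy_factor_def mat_def)
  thus ?thesis
    using eq_or_eq_uminus[of A "mat 1" z] assms by simp
qed

text \<open>By \<open>act_diff\<close> the local parameter at the image point is w - z times a
  nonvanishing analytic factor, which the cofactor absorbs.\<close>

lemma has_order_compose_act: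
  assumes "det A = 1" "z \<in> uhp" "has_order f (act A z) n"
  shows   "has_order (\<lambda>w. f (act A w)) z n"
proof -
  obtain g where g: "g analytic_on {act A z}" "g (act A z) \<noteq> 0"
    "\<forall>\<^sub>F w in at (act A z). f w = g w * (w - act A z) powi n"
    using assms(3) by (auto simp: has_order_def)
  let ?j = "automorphy_factor A"
  have anl: "act A analytic_on {z}"
    using analytic_act[OF assms(1)] by (rule analytic_on_subset) (use assms in auto)
  show ?thesis
  proof (rule has_orderI)
    have "(g \<circ> act A) analytic_on {z}"
      using anl g(1) by (intro analytic_on_compose) auto
    hence "(\<lambda>w. g (act A w)) analytic_on {z}"
      by (simp add: o_def)
    moreover have "(\<lambda>w. (?j w * ?j z) powi (- n)) analytic_on {z}"
      using automorphy_factor_nonzero[OF assms(1,2)]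
      by (intro analytic_on_power_int analytic_on_mult analytic_automorphy_factor analytic_on_const) auto
    ultimately show "(\<lambda>w. g (act A w) * (?j w * ?j z) powi (- n)) analytic_on {z}"
      by (rule analytic_on_mult)
    have "\<forall>\<^sub>F w in at z. w \<in> uhp"
      using eventually_in_uhp[OF assms(2)] by (simp add: eventually_nhds_conv_at)
    thus "\<forall>\<^sub>F w in at z. f (act A w) = g (act A w) * (?j w * ?j z) powi (- n) * (w - z) powi n"
      using eventually_at_act[OF assms(1,2) g(3)]
    proof eventually_elim
      case (elim w)
      show ?case
        using elim(2) by (simp add: act_diff[OF assms(1) elim(1) assms(2)] power_int_divide_distrib
            power_int_minus field_simps)
    qed
  qed (use g(2) automorphy_factor_nonzero[OF assms(1,2)] in auto)
qed

text \<open>Composition inside \<open>remove_sings\<close> calls for equality of the two filters,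
  not merely for a limit; the second inclusion comes from the inverse matrix.\<close>

lemma filtermap_act:
  assumes "det A = 1" "det B = 1" "A ** B = mat 1" "B ** A = mat 1" "z \<in> uhp"
  shows   "filtermap (act A) (at z) = at (act A z)"
proof (rule antisym)
  show "filtermap (act A) (at z) \<le> at (act A z)"
    using filterlim_act[OF assms(1,5)] by (simp add: filterlim_def)
  have B: "act B (act A z) = z"
    using act_mult[OF assms(2,1,5)] assms(4) by simp
  have uhp: "act A z \<in> uhp"
    using act_in_uhp[OF assms(1,5)] .
  have "\<forall>\<^sub>F w in at (act A z). w \<in> uhp"
    using eventually_in_uhp[OF uhp] by (simp add: eventually_nhds_conv_at)
  hence inv: "\<forall>\<^sub>F w in at (act A z). act A (act B w) = w"
    by eventually_elim (use act_mult[OF assms(1,2)] assms(3) in simp)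
  show "at (act A z) \<le> filtermap (act A) (at z)"
    unfolding le_filter_def eventually_filtermap
  proof (intro allI impI)
    fix P assume "\<forall>\<^sub>F w in at z. P (act A w)"
    hence "\<forall>\<^sub>F w in at (act A z). P (act A (act B w))"
      by (intro eventually_at_act[OF assms(2) uhp]) (simp add: B)
    thus "\<forall>\<^sub>F w in at (act A z). P w"
      using inv by eventually_elim simp
  qed
qed

lemma group_SL2R: "group SL2R"
proof (rule groupI)
  fix A assume "A \<in> carrier SL2R"
  hence A: "det A = 1" by (simp add: SL2R_def)
  hence "invertible A" by (simp add: invertible_det_nz)
  then obtain B where B: "A ** B = mat 1" "B ** A = mat 1"
    by (auto simp: invertible_def)
  have "det B = 1"
    using arg_cong[OF B(1), of det] A by (simp add: det_mul)
  thus "\<exists>B\<in>carrier SL2R. B \<otimes>\<^bsub>SL2R\<^esub> A = \<one>\<^bsub>SL2R\<^esub>"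
    using B by (auto simp: SL2R_def)
qed (auto simp: SL2R_def det_mul matrix_mul_assoc)

section \<open>Invariance under a subgroup of SL(2,R)\<close>

locale SL2_subgroup =
  fixes \<Gamma> :: "(real^2^2) set"
  assumes subgroup_SL2R: "subgroup \<Gamma> SL2R"
begin

lemma det_1: "A \<in> \<Gamma> \<Longrightarrow> det A = 1"
  using subgroup.subset[OF subgroup_SL2R] by (auto simp: SL2R_def)

lemma one_mem: "mat 1 \<in> \<Gamma>"
  using subgroup.one_closed[OF subgroup_SL2R] by (simp add: SL2R_def)

lemma mult_mem: "A \<in> \<Gamma> \<Longrightarrow> B \<in> \<Gamma> \<Longrightarrow> A ** B \<in> \<Gamma>"
  using subgroup.m_closed[OF subgroup_SL2R, of A B] by (simp add: SL2R_def)

lemma inverse_mem: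
  assumes "A \<in> \<Gamma>"
  obtains B where "B \<in> \<Gamma>" "A ** B = mat 1" "B ** A = mat 1"
proof
  have A: "A \<in> carrier SL2R"
    using subgroup.subset[OF subgroup_SL2R] assms by auto
  show "inv\<^bsub>SL2R\<^esub> A \<in> \<Gamma>"
    using subgroup.m_inv_closed[OF subgroup_SL2R assms] .
  show "A ** inv\<^bsub>SL2R\<^esub> A = mat 1"
    using group.r_inv[OF group_SL2R A] by (simp add: SL2R_def)
  show "inv\<^bsub>SL2R\<^esub> A ** A = mat 1"
    using group.l_inv[OF group_SL2R A] by (simp add: SL2R_def)
qed

lemma act_mem_uhp: "A \<in> \<Gamma> \<Longrightarrow> z \<in> uhp \<Longrightarrow> act A z \<in> uhp"
  using act_in_uhp det_1 by blast

lemma remove_sings_invariant: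
  assumes "A \<in> \<Gamma>" "z \<in> uhp" "\<forall>\<^sub>F w in at z. f (act A w) = f w"
  shows   "remove_sings f (act A z) = remove_sings f z"
proof -
  obtain B where B: "B \<in> \<Gamma>" "A ** B = mat 1" "B ** A = mat 1"
    using inverse_mem[OF assms(1)] .
  have "remove_sings f (act A z) = remove_sings (f \<circ> act A) z"
    using remove_sings_compose[OF filtermap_act[OF det_1[OF assms(1)] det_1[OF B(1)] B(2,3) assms(2)]]
    by simp
  also have "\<dots> = remove_sings f z"
    using assms(3) by (intro remove_sings_cong) simp_all
  finally show ?thesis .
qed

text \<open>The inverse of B times A fixes both points, so \<open>act_two_fixed_points\<close>
  applies. This is what deduces countability of a group from countability of its orbits.\<close>

lemma eq_or_eq_uminus_of_two_points:
  assumes "A \<in> \<Gamma>" "B \<in> \<Gamma>" "z \<in> uhp" "w \<in> uhp" "z \<noteq> w"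
    "act A z = act B z" "act A w = act B w"
  shows   "A = B \<or> A = - B"
proof -
  obtain C where C: "C \<in> \<Gamma>" "C ** B = mat 1" "B ** C = mat 1" using assms inverse_mem by metis
  have "act (C ** A) u = u" if "u \<in> uhp" "act A u = act B u" for u
    using act_mult[of C A u] act_mult[of C B u] that assms C det_1 by simp
  hence "C ** A = mat 1 \<or> C ** A = - mat 1"
    using act_two_fixed_points[of "C ** A" z w] assms mult_mem[OF C(1) assms(1)] det_1 by auto
  moreover have "A = B ** (C ** A)"
    by (simp add: matrix_mul_assoc C)
  moreover have "B ** (- mat 1) = - B"
    by (simp add: matrix_matrix_mult_def vec_eq_iff mat_def sum_2 forall_2)
  ultimately show ?thesis
    by (metis matrix_mul_rid)
qed

end

subsection \<open>Stabilizers and ramification\<close>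

text \<open>Allows the classes {A, -A} of a stabilizer to be counted by their multipliers.\<close>

lemma card_image_eq_card_image:
  assumes "\<And>x y. x \<in> S \<Longrightarrow> y \<in> S \<Longrightarrow> f x = f y \<longleftrightarrow> g x = g y"
  shows   "card (f ` S) = card (g ` S)"
proof -
  have "bij_betw (g \<circ> inv_into S f) (f ` S) (g ` S)"
  proof (rule bij_betw_imageI)
    have *: "g (inv_into S f (f x)) = g x" if "x \<in> S" for x
      using that assms[of "inv_into S f (f x)" x] by (simp add: f_inv_into_f inv_into_into)
    show "inj_on (g \<circ> inv_into S f) (f ` S)"
      using * assms by (auto simp: inj_on_def)
    show "(g \<circ> inv_into S f) ` f ` S = g ` S"
      using * by (simp add: image_image)
  qed
  thus ?thesis
    by (rule bij_betw_same_card)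
qed

lemma analytic_nth_root:
  assumes "g analytic_on {z}" "g z \<noteq> 0" "n > 0"
  obtains h where "h analytic_on {z}" "h z \<noteq> 0" "\<forall>\<^sub>F w in nhds z. h w ^ n = g w"
proof -
  \<comment> \<open>Division by g z moves the value at z to 1, away from the branch cut of
    \<open>Ln\<close>; the constant factor restores the root of g z.\<close>
  define h where "h = (\<lambda>w. exp (Ln (g z) / of_nat n) * exp (Ln (g w / g z) / of_nat n))"
  have "h analytic_on {z}"
    unfolding h_def using assms by (intro analytic_intros) auto
  moreover have "h z \<noteq> 0"
    by (simp add: h_def)
  moreover have "\<forall>\<^sub>F w in nhds z. h w ^ n = g w"
    using analytic_nonzero_eventually[OF assms(1,2)]
  proof eventually_elim
    case (elim w)
    have "exp (Ln u / of_nat n) ^ n = u" if "u \<noteq> 0" for u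
    proof -
      have "exp (Ln u / of_nat n) ^ n = exp (of_nat n * (Ln u / of_nat n))"
        by (rule exp_of_nat_mult[symmetric])
      thus ?thesis using that assms(3) by simp
    qed
    thus ?case
      using elim assms(2) by (simp add: h_def power_mult_distrib)
  qed
  ultimately show ?thesis using that by blast
qed

lemma open_imp_fsigma:
  fixes S :: "'a :: euclidean_space set"
  assumes "open S"
  shows   "fsigma S"
proof -
  obtain C :: "nat \<Rightarrow> 'a set" where "\<And>n. compact (C n)" "\<Union>(range C) = S"
    using open_Union_compact_subsets[OF assms] by metis
  thus ?thesis
    unfolding fsigma_Union_compact by (intro exI[of _ C]) auto
qed

text \<open>If h is an n-th root of the cofactor, then \<phi> = (w - z) h has derivative h(z)
  \<noteq> 0 at z, so it is a coordinate in which s - s z is the n-th power.\<close>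

lemma local_coordinate:
  assumes "has_order (\<lambda>w. s w - s z) z (int n)" "n > 0" "s analytic_on {z}" "open U" "z \<in> U"
  obtains \<phi> r where "r > 0" "\<phi> holomorphic_on ball z r" "\<phi> z = 0" "inj_on \<phi> (ball z r)"
    "open (\<phi> ` ball z r)" "\<And>w. w \<in> ball z r \<Longrightarrow> s w - s z = \<phi> w ^ n" "ball z r \<subseteq> U"
proof -
  obtain g where g: "g analytic_on {z}" "g z \<noteq> 0"
    "\<forall>\<^sub>F w in at z. s w - s z = g w * (w - z) powi (int n)"
    using assms(1) by (auto simp: has_order_def)
  obtain h where h: "h analytic_on {z}" "h z \<noteq> 0" "\<forall>\<^sub>F w in nhds z. h w ^ n = g w"
    using analytic_nth_root[OF g(1,2) assms(2)] .
  define \<phi> where "\<phi> = (\<lambda>w. (w - z) * h w)"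
  have \<phi>: "\<phi> analytic_on {z}"
    unfolding \<phi>_def using h(1) by (intro analytic_intros)
  have "(\<phi> has_field_derivative h z) (at z)"
  proof -
    have "(h has_field_derivative deriv h z) (at z)"
      using h(1) analytic_on_imp_differentiable_at DERIV_deriv_iff_field_differentiable by blast
    thus ?thesis
      unfolding \<phi>_def by (auto intro!: derivative_eq_intros)
  qed
  hence d: "deriv \<phi> z \<noteq> 0"
    using h(2) by (simp add: DERIV_imp_deriv)
  have "\<forall>\<^sub>F w in nhds z. s w - s z = g w * (w - z) ^ n"
    using g(3) assms(2) by (simp add: eventually_nhds_conv_at)
  hence "\<forall>\<^sub>F w in nhds z. s w - s z = \<phi> w ^ n"
    using h(3) by eventually_elim (simp add: \<phi>_def power_mult_distrib mult.commute)
  moreover have "\<forall>\<^sub>F w in nhds z. w \<in> U"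
    using assms(4,5) by (rule eventually_nhds_in_open)
  ultimately have "\<forall>\<^sub>F w in nhds z. s w - s z = \<phi> w ^ n \<and> \<phi> analytic_on {w} \<and> w \<in> U"
    using eventually_nhds_analytic_at[OF \<phi>] by eventually_elim auto
  then obtain S where S: "open S" "z \<in> S"
    "\<And>w. w \<in> S \<Longrightarrow> s w - s z = \<phi> w ^ n \<and> \<phi> analytic_on {w} \<and> w \<in> U"
    by (auto simp: eventually_nhds)
  have hol: "\<phi> holomorphic_on S"
    using S(3) analytic_imp_holomorphic analytic_on_analytic_at by blast
  obtain r where r: "r > 0" "ball z r \<subseteq> S" "open (\<phi> ` ball z r)" "inj_on \<phi> (ball z r)"
    using has_complex_derivative_locally_invertible[OF hol S(2,1) d] .
  show ?thesis
  proof (rule that[OF r(1) _ _ r(4,3)])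
    show "\<phi> holomorphic_on ball z r"
      using hol r(2) holomorphic_on_subset by blast
  qed (use S r in \<open>auto simp: \<phi>_def\<close>)
qed

text \<open>The multiplier 1/j^2 of A at its fixed point z, with j = cz + d, embeds the stabilizer
  modulo sign into the complex numbers, and its image is the group of n-th roots of unity. The
  function s is kept general so that it can be t at a finite value and 1/t at a pole.\<close>

lemma (in SL2_subgroup) stabilizer_order_eq_order:
  assumes "countable \<Gamma>" "z \<in> uhp"
    and "s analytic_on {z}" "has_order (\<lambda>w. s w - s z) z (int n)" "n > 0"
    and inv: "\<And>A. A \<in> \<Gamma> \<Longrightarrow> act A z = z \<Longrightarrow> \<forall>\<^sub>F w in at z. s (act A w) = s w"
    and "open U" "z \<in> U" "U \<subseteq> uhp"
    and fib: "\<And>w w'. w \<in> U \<Longrightarrow> w' \<in> U \<Longrightarrow> s w = s w' \<Longrightarrow> equivalent \<Gamma> w w'"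
  shows "stabilizer_order \<Gamma> z = n"
proof -
  define S where "S = {A \<in> \<Gamma>. act A z = z}"
  let ?j = "\<lambda>A. automorphy_factor A z"
  \<comment> \<open>Substituting the action into s - s z = g (w - z)^n multiplies the leading
    coefficient g z by j^(-2n), while invariance preserves it.\<close>
  have root: "(1 / ?j A ^ 2) ^ n = 1" if A: "A \<in> S" for A
  proof -
    have A: "A \<in> \<Gamma>" "act A z = z" "det A = 1"
      using that det_1 by (auto simp: S_def)
    obtain g where g: "g analytic_on {z}" "g z \<noteq> 0"
      "\<forall>\<^sub>F w in at z. s w - s z = g w * (w - z) powi (int n)"
      using assms(4) by (auto simp: has_order_def)
    let ?J = "\<lambda>w. automorphy_factor A w * ?j A"
    have "\<forall>\<^sub>F w in at z. s (act A w) - s z = g (act A w) * (act A w - z) powi (int n)"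
      using eventually_at_act[OF A(3) assms(2), of "\<lambda>w. s w - s z = g w * (w - z) powi (int n)"]
        g(3) A(2) by simp
    moreover have "\<forall>\<^sub>F w in at z. w \<in> uhp"
      using eventually_in_uhp[OF assms(2)] by (simp add: eventually_nhds_conv_at)
    ultimately have ev: "\<forall>\<^sub>F w in at z. g (act A w) = g w * ?J w ^ n"
      using inv[OF A(1,2)] g(3) eventually_neq_at_within[of z z]
    proof eventually_elim
      case (elim w)
      have J: "?J w \<noteq> 0"
        using automorphy_factor_nonzero[OF A(3)] elim(2) assms(2) by auto
      have "act A w - z = (w - z) / ?J w"
        using act_diff[OF A(3) elim(2) assms(2)] A(2) by simp
      hence "g (act A w) * ((w - z) / ?J w) ^ n = g w * (w - z) ^ n"
        using elim(1,3,4) by simp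
      hence "g (act A w) * (w - z) ^ n = (g w * ?J w ^ n) * (w - z) ^ n"
        using J by (simp only: power_divide times_divide_eq_right divide_eq_eq) (simp add: mult_ac)
      thus ?case
        using elim(5) by (metis eq_iff_diff_eq_0 mult_right_cancel power_not_zero)
    qed
    have anl: "act A analytic_on {z}"
      using analytic_act[OF A(3)] by (rule analytic_on_subset) (use assms in auto)
    have "(g \<circ> act A) analytic_on {z}"
      using anl g(1) A(2) by (intro analytic_on_compose) auto
    hence "(g \<circ> act A) \<midarrow>z\<rightarrow> g z"
      using analytic_at_imp_isCont A(2) by (fastforce simp: isCont_def)
    moreover have "(\<lambda>w. g w * ?J w ^ n) analytic_on {z}"
      using g(1) by (intro analytic_on_mult analytic_on_power analytic_automorphy_factor analytic_on_const)
    hence "(\<lambda>w. g w * ?J w ^ n) \<midarrow>z\<rightarrow> g z * ?J z ^ n"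
      using analytic_at_imp_isCont by (fastforce simp: isCont_def)
    hence "(g \<circ> act A) \<midarrow>z\<rightarrow> g z * ?J z ^ n"
      by (rule Lim_transform_eventually) (use ev in \<open>auto elim: eventually_mono\<close>)
    ultimately have "g z = g z * ?J z ^ n"
      by (rule LIM_unique)
    hence "(?j A ^ 2) ^ n = 1"
      using g(2) by (simp add: power2_eq_square)
    thus ?thesis
      by (simp add: power_one_over)
  qed
  \<comment> \<open>The rotation u -> \<zeta> u of the coordinate permutes the sheets of s. By
    \<open>fib\<close> some A depending on u realizes it at each u; countability of \<Gamma> yields
    one A for uncountably many u.\<close>
  have surj: "\<exists>A\<in>S. 1 / ?j A ^ 2 = \<zeta>" if \<zeta>: "\<zeta> ^ n = 1" for \<zeta>
  proof -
    obtain \<phi> r where \<phi>: "r > 0" "\<phi> holomorphic_on ball z r" "\<phi> z = 0" "inj_on \<phi> (ball z r)"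
      "open (\<phi> ` ball z r)" "\<And>w. w \<in> ball z r \<Longrightarrow> s w - s z = \<phi> w ^ n" "ball z r \<subseteq> U"
      using local_coordinate[OF assms(4,5,3,7,8)] by metis
    obtain h where h: "h holomorphic_on \<phi> ` ball z r" "\<And>w. w \<in> ball z r \<Longrightarrow> h (\<phi> w) = w"
      "\<And>w. w \<in> ball z r \<Longrightarrow> deriv \<phi> w * deriv h (\<phi> w) = 1"
      using holomorphic_has_inverse[OF \<phi>(2) open_ball \<phi>(4)] by metis
    have h0: "h 0 = z" "deriv h 0 \<noteq> 0"
      using h(2)[of z] h(3)[of z] \<phi>(1,3) by auto
    have "0 \<in> \<phi> ` ball z r"
      using \<phi>(1,3) by (metis centre_in_ball imageI)
    then obtain \<delta> where \<delta>: "\<delta> > 0" "ball 0 \<delta> \<subseteq> \<phi> ` ball z r"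
      using \<phi>(5) by (meson open_contains_ball)
    have h_ball: "h u \<in> ball z r" "\<phi> (h u) = u" if u: "u \<in> ball 0 \<delta>" for u
    proof -
      obtain w where "w \<in> ball z r" "u = \<phi> w"
        using \<delta>(2) u by blast
      thus "h u \<in> ball z r" "\<phi> (h u) = u"
        using h(2) by auto
    qed
    have n\<zeta>: "norm \<zeta> = 1"
    proof (rule power_eq_imp_eq_base)
      show "norm \<zeta> ^ n = 1 ^ n"
        using \<zeta> by (metis norm_one norm_power power_one)
    qed (use assms(5) in auto)
    have \<zeta>_ball: "\<zeta> * u \<in> ball 0 \<delta>" if "u \<in> ball 0 \<delta>" for u
      using that n\<zeta> by (simp add: norm_mult)
    have ex: "\<exists>A\<in>\<Gamma>. act A (h u) = h (\<zeta> * u)" if u: "u \<in> ball 0 \<delta>" for u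
    proof -
      have "s (h u) - s z = s (h (\<zeta> * u)) - s z"
        using h_ball[OF u] h_ball[OF \<zeta>_ball[OF u]] \<phi>(6) by (simp add: power_mult_distrib \<zeta>)
      moreover have "h u \<in> U" "h (\<zeta> * u) \<in> U"
        using h_ball(1)[OF u] h_ball(1)[OF \<zeta>_ball[OF u]] \<phi>(7) by blast+
      ultimately have "equivalent \<Gamma> (h u) (h (\<zeta> * u))"
        by (intro fib) auto
      thus ?thesis by (auto simp: equivalent_def)
    qed
    have "\<exists>A\<in>\<Gamma>. uncountable {u \<in> ball 0 \<delta>. act A (h u) = h (\<zeta> * u)}"
    proof (rule ccontr)
      assume "\<not> ?thesis"
      hence "countable (\<Union>A\<in>\<Gamma>. {u \<in> ball 0 \<delta>. act A (h u) = h (\<zeta> * u)})"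
        using assms(1) by (intro countable_UN) auto
      moreover have "ball 0 \<delta> \<subseteq> (\<Union>A\<in>\<Gamma>. {u \<in> ball 0 \<delta>. act A (h u) = h (\<zeta> * u)})"
        using ex by auto
      ultimately have "countable (ball (0::complex) \<delta>)"
        using countable_subset by blast
      thus False
        using uncountable_ball[OF \<delta>(1), of "0::complex"] by simp
    qed
    then obtain A where A: "A \<in> \<Gamma>" "uncountable {u \<in> ball 0 \<delta>. act A (h u) = h (\<zeta> * u)}"
      by blast
    have hol_h: "h holomorphic_on ball 0 \<delta>"
      using h(1) \<delta>(2) holomorphic_on_subset by blast
    \<comment> \<open>Holomorphic functions that agree on an uncountable subset of a disc agree on
      the whole disc.\<close>
    have eq: "ball 0 \<delta> \<subseteq> {u \<in> ball 0 \<delta>. act A (h u) = h (\<zeta> * u)}"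
    proof (rule holomorphic_countable_equal[OF _ _ open_ball connected_ball _ A(2)])
      have "h ` ball 0 \<delta> \<subseteq> uhp"
        using h_ball(1) \<phi>(7) \<open>U \<subseteq> uhp\<close> by blast
      hence "act A \<circ> h holomorphic_on ball 0 \<delta>"
        by (intro holomorphic_on_compose_gen[OF hol_h holomorphic_act[OF det_1[OF A(1)]]])
      thus "(\<lambda>u. act A (h u)) holomorphic_on ball 0 \<delta>"
        by (simp add: o_def)
      have "h \<circ> (\<lambda>u. \<zeta> * u) holomorphic_on ball 0 \<delta>"
        using \<zeta>_ball by (intro holomorphic_on_compose_gen[OF _ hol_h] holomorphic_intros) auto
      thus "(\<lambda>u. h (\<zeta> * u)) holomorphic_on ball 0 \<delta>"
        by (simp add: o_def)
      show "fsigma (ball (0::complex) \<delta>)"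
        by (simp add: open_imp_fsigma)
    qed
    have fix_z: "act A z = z"
      using eq h0(1) \<delta>(1) by (force dest: subsetD[of _ _ 0])
    hence "A \<in> S"
      using A(1) by (simp add: S_def)
    have d1: "((\<lambda>u. act A (h u)) has_field_derivative 1 / ?j A ^ 2 * deriv h 0) (at 0)"
    proof (rule DERIV_chain2[where f = "act A"])
      show "(act A has_field_derivative 1 / ?j A ^ 2) (at (h 0))"
        using has_field_derivative_act[OF det_1[OF A(1)] assms(2)] h0 by simp
      show "(h has_field_derivative deriv h 0) (at 0)"
        using hol_h \<delta>(1) by (intro holomorphic_derivI[where S = "ball 0 \<delta>"]) auto
    qed
    have d2: "((\<lambda>u. h (\<zeta> * u)) has_field_derivative deriv h 0 * \<zeta>) (at 0)"
    proof (rule DERIV_chain2[where f = h])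
      show "(h has_field_derivative deriv h 0) (at (\<zeta> * 0))"
        using hol_h \<delta>(1) by (auto intro!: holomorphic_derivI[where S = "ball 0 \<delta>"])
    qed (auto intro!: derivative_eq_intros)
    have "\<forall>\<^sub>F u in nhds 0. act A (h u) = h (\<zeta> * u)"
    proof -
      have "\<forall>\<^sub>F u in nhds (0::complex). u \<in> ball 0 \<delta>"
        using \<delta>(1) by (intro eventually_nhds_in_open) auto
      thus ?thesis by eventually_elim (use eq in auto)
    qed
    hence "((\<lambda>u. h (\<zeta> * u)) has_field_derivative 1 / ?j A ^ 2 * deriv h 0) (at 0)"
      using d1 DERIV_cong_ev[of 0 0 "\<lambda>u. act A (h u)" "\<lambda>u. h (\<zeta> * u)"] by blast
    \<comment> \<open>Both sides are the derivative at 0 of the rotated inverse chart, which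
      identifies the multiplier of A as \<zeta>.\<close>
    with d2 have "1 / ?j A ^ 2 * deriv h 0 = deriv h 0 * \<zeta>"
      using DERIV_unique by blast
    hence "1 / ?j A ^ 2 = \<zeta>"
      using h0(2) by (metis mult.commute mult_right_cancel)
    with \<open>A \<in> S\<close> show ?thesis by blast
  qed
  have "stabilizer_order \<Gamma> z = card ((\<lambda>A. {A, - A}) ` S)"
    by (simp add: stabilizer_order_def S_def)
  also have "\<dots> = card ((\<lambda>A. 1 / ?j A ^ 2) ` S)"
  proof (rule card_image_eq_card_image)
    fix A B assume AB: "A \<in> S" "B \<in> S"
    show "{A, - A} = {B, - B} \<longleftrightarrow> 1 / ?j A ^ 2 = 1 / ?j B ^ 2"
    proof
      assume "{A, - A} = {B, - B}"
      hence "A = B \<or> A = - B" by (auto simp: doubleton_eq_iff)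
      thus "1 / ?j A ^ 2 = 1 / ?j B ^ 2"
      proof
        assume "A = - B"
        hence "?j A = - ?j B" by (simp add: automorphy_factor_def)
        thus ?thesis by simp
      qed auto
    next
      assume "1 / ?j A ^ 2 = 1 / ?j B ^ 2"
      hence "?j A ^ 2 = ?j B ^ 2" by simp
      hence "A = B \<or> A = - B"
        using eq_or_eq_uminus[of A B z] AB assms(2) det_1 by (auto simp: S_def)
      thus "{A, - A} = {B, - B}" by auto
    qed
  qed
  also have "(\<lambda>A. 1 / ?j A ^ 2) ` S = {\<zeta>. \<zeta> ^ n = 1}"
    using root surj by (auto simp: image_iff)
  also have "card \<dots> = n"
    using assms(5) by (rule card_roots_unity_eq)
  finally show ?thesis .
qed

subsection \<open>Hauptmoduln\<close>

locale hauptmodul_curve = SL2_subgroup +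
  fixes t :: "complex \<Rightarrow> complex"
  assumes hauptmodul: "hauptmodul \<Gamma> t"
begin

lemma t_nicely_meromorphic: "t nicely_meromorphic_on uhp"
  and t_invariant: "A \<in> \<Gamma> \<Longrightarrow> z \<in> uhp \<Longrightarrow> t (act A z) = t z"
  using hauptmodul by (auto simp: hauptmodul_def modular_functions_def)

lemma t_meromorphic: "t meromorphic_on uhp"
  using t_nicely_meromorphic by (simp add: nicely_meromorphic_on_def)

lemma quotient_map_t:
  "quotient_map (top_of_set uhp) (Alexandroff_compactification euclidean) (sphere_value t)"
  using hauptmodul by (simp add: hauptmodul_def induces_homeo_def)

lemma sphere_value_eq_iff:
  "z \<in> uhp \<Longrightarrow> w \<in> uhp \<Longrightarrow> sphere_value t z = sphere_value t w \<longleftrightarrow> equivalent \<Gamma> z w"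
  using hauptmodul by (simp add: hauptmodul_def induces_homeo_def)

lemma sphere_value_surj: obtains z where "z \<in> uhp" "sphere_value t z = v"
proof -
  have "sphere_value t ` uhp = UNIV"
    using quotient_imp_surjective_map[OF quotient_map_t] by (simp add: UNIV_option_conv)
  thus ?thesis using that by (metis UNIV_I imageE)
qed

lemma t_analytic_at: "z \<in> uhp \<Longrightarrow> \<not> is_pole t z \<Longrightarrow> t analytic_on {z}"
  using nicely_meromorphic_on_imp_analytic_at[OF t_nicely_meromorphic] .

lemma t_pole_value:
  assumes "z \<in> uhp" "is_pole t z"
  shows   "t z = 0"
  using t_nicely_meromorphic assms not_tendsto_and_filterlim_at_infinity[OF at_neq_bot]
  unfolding nicely_meromorphic_on_def is_pole_def by blast

lemma eventually_analytic:
  assumes "z \<in> uhp"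
  shows   "\<forall>\<^sub>F w in at z. w \<in> uhp \<and> t analytic_on {w}"
proof -
  have "\<forall>\<^sub>F w in at z. t analytic_on {w}"
    using eventually_cosparse_imp_eventually_at[OF meromorphic_on_imp_analytic_cosparse[OF t_meromorphic] assms] .
  moreover have "\<forall>\<^sub>F w in at z. w \<in> uhp"
    using eventually_in_uhp[OF assms] by (simp add: eventually_nhds_conv_at)
  ultimately show ?thesis by eventually_elim auto
qed

lemma eventually_t_neq:
  assumes "z \<in> uhp"
  shows   "\<forall>\<^sub>F w in at z. t w \<noteq> c"
proof -
  have "\<not> (\<forall>x\<in>uhp. t x = c)"
  proof
    assume *: "\<forall>x\<in>uhp. t x = c"
    obtain x where x: "x \<in> uhp" "sphere_value t x = Some (c + 1)"
      by (rule sphere_value_surj)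
    thus False using * by (auto simp: sphere_value_def split: if_splits)
  qed
  hence "\<forall>\<^sub>\<approx>x\<in>uhp. t x \<noteq> c"
    using nicely_meromorphic_imp_constant_or_avoid[OF t_nicely_meromorphic open_uhp connected_uhp, of c]
    by blast
  thus ?thesis
    using assms by (rule eventually_cosparse_imp_eventually_at)
qed

text \<open>An orbit lies in one fibre of \<open>sphere_value t\<close>, and the fibres of a
  nonconstant meromorphic function are sparse, hence countable.\<close>

lemma countable_orbit:
  assumes "z \<in> uhp"
  shows   "countable ((\<lambda>A. act A z) ` \<Gamma>)"
proof -
  define v where "v = sphere_value t z"
  have "{w. sphere_value t w = v} sparse_in uhp"
    unfolding sparse_in_eventually_iff[OF open_uhp]
  proof
    fix y assume y: "y \<in> uhp"
    show "\<forall>\<^sub>F y in at y. y \<notin> {w. sphere_value t w = v}"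
      \<comment> \<open>For v = \<open>None\<close> the number \<open>the v\<close> is unspecified;
        in that case analyticity of t at the nearby points already excludes the value.\<close>
      using eventually_analytic[OF y] eventually_t_neq[OF y, of "the v"]
      by eventually_elim (auto simp: sphere_value_def dest: analytic_at_imp_no_pole)
  qed
  hence "countable (uhp \<inter> {w. sphere_value t w = v})"
    using sparse_imp_countable open_uhp by blast
  moreover have "(\<lambda>A. act A z) ` \<Gamma> \<subseteq> uhp \<inter> {w. sphere_value t w = v}"
  proof
    fix w assume "w \<in> (\<lambda>A. act A z) ` \<Gamma>"
    then obtain A where A: "A \<in> \<Gamma>" "w = act A z" by blast
    thus "w \<in> uhp \<inter> {w. sphere_value t w = v}"
      using sphere_value_eq_iff[of z w] act_mem_uhp[of A z] assms
      by (auto simp: v_def equivalent_def)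
  qed
  ultimately show ?thesis
    using countable_subset by blast
qed

text \<open>An element of \<open>\<Gamma>\<close> is determined up to sign by the images of two points.\<close>

lemma countable_group: "countable \<Gamma>"
proof -
  define F where "F = (\<lambda>A. (act A \<i>, act A (2 * \<i>)))"
  have pts: "\<i> \<in> uhp" "2 * \<i> \<in> uhp" by (auto simp: uhp_def)
  have "F ` \<Gamma> \<subseteq> (\<lambda>A. act A \<i>) ` \<Gamma> \<times> (\<lambda>A. act A (2 * \<i>)) ` \<Gamma>"
    by (auto simp: F_def)
  hence "countable (F ` \<Gamma>)"
    using countable_orbit[OF pts(1)] countable_orbit[OF pts(2)] countable_SIGMA countable_subset
    by (metis (no_types, lifting))
  moreover have "countable {A \<in> \<Gamma>. F A = p}" if "p \<in> F ` \<Gamma>" for p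
  proof -
    from that obtain B where B: "B \<in> \<Gamma>" "p = F B" by blast
    have "{A \<in> \<Gamma>. F A = p} \<subseteq> {B, - B}"
      using eq_or_eq_uminus_of_two_points[OF _ B(1) pts] by (auto simp: B(2) F_def)
    thus ?thesis by (meson countable_finite finite.emptyI finite.insertI finite_subset)
  qed
  ultimately have "countable (\<Union>p\<in>F ` \<Gamma>. {A \<in> \<Gamma>. F A = p})"
    by (intro countable_UN)
  moreover have "\<Gamma> \<subseteq> (\<Union>p\<in>F ` \<Gamma>. {A \<in> \<Gamma>. F A = p})" by auto
  ultimately show ?thesis using countable_subset by blast
qed

text \<open>Where t has no poles, equal values of t are equal points of the sphere, so two points
  with the same value lie in one orbit, as \<open>stabilizer_order_eq_order\<close>
  requires.\<close>

lemma order_at_finite: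
  assumes "z \<in> uhp" "\<not> is_pole t z"
  shows   "stabilizer_order \<Gamma> z > 0"
    and   "has_order (\<lambda>w. t w - t z) z (int (stabilizer_order \<Gamma> z))"
proof -
  have anl: "t analytic_on {z}" by (rule t_analytic_at) fact+
  hence anl': "(\<lambda>w. t w - t z) analytic_on {z}" by (intro analytic_intros)
  have "\<forall>\<^sub>F w in at z. t w - t z \<noteq> 0"
    using eventually_t_neq[OF assms(1), of "t z"] by eventually_elim auto
  then obtain k where k: "has_order (\<lambda>w. t w - t z) z k"
    using has_order_exists[OF analytic_on_imp_meromorphic_on[OF anl']] eventually_frequently
      at_neq_bot by metis
  hence "k > 0"
    using has_order_analytic_zero_imp_pos[OF k anl'] by simp
  have "\<forall>\<^sub>F w in nhds z. w \<in> uhp \<and> t analytic_on {w}"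
    using eventually_nhds_analytic_at[OF anl] eventually_in_uhp[OF assms(1)] by eventually_elim auto
  then obtain U where U: "open U" "z \<in> U" "\<And>w. w \<in> U \<Longrightarrow> w \<in> uhp \<and> t analytic_on {w}"
    by (auto simp: eventually_nhds)
  have "stabilizer_order \<Gamma> z = nat k"
  proof (rule stabilizer_order_eq_order[OF countable_group assms(1) anl _ _ _ U(1,2)])
    show "has_order (\<lambda>w. t w - t z) z (int (nat k))"
      using k \<open>k > 0\<close> by simp
    show "\<forall>\<^sub>F w in at z. t (act A w) = t w" if "A \<in> \<Gamma>" for A
      using eventually_analytic[OF assms(1)] by eventually_elim (use t_invariant that in auto)
    show "equivalent \<Gamma> w w'" if "w \<in> U" "w' \<in> U" "t w = t w'" for w w'
      using sphere_value_eq_iff[of w w'] U(3)[of w] U(3)[of w'] that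
      by (auto simp: sphere_value_def dest!: analytic_at_imp_no_pole)
  qed (use \<open>k > 0\<close> U in auto)
  thus "stabilizer_order \<Gamma> z > 0" "has_order (\<lambda>w. t w - t z) z (int (stabilizer_order \<Gamma> z))"
    using k \<open>k > 0\<close> by auto
qed

text \<open>The chart 1/t at infinity takes the role of t - t z.\<close>

lemma order_at_pole:
  assumes "z \<in> uhp" "is_pole t z"
  shows   "stabilizer_order \<Gamma> z > 0"
    and   "has_order t z (- int (stabilizer_order \<Gamma> z))"
proof -
  define s where "s = (\<lambda>w. inverse (t w))"
  \<comment> \<open>The dummy value t z = 0 and the convention inverse 0 = 0 give s exactly its
    limit at the pole, so s needs no correction there.\<close>
  have sz: "s z = 0" using t_pole_value[OF assms] by (simp add: s_def)
  have mero: "t meromorphic_on {z}"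
    using t_meromorphic assms(1) by (auto intro: meromorphic_on_subset)
  obtain k where k: "has_order t z k"
    using has_order_exists[OF mero] eventually_frequently[OF at_neq_bot eventually_t_neq[OF assms(1)]]
    by metis
  hence "k < 0"
    using has_order_pole_imp_neg assms(2) by blast
  have s_order: "has_order s z (- k)"
    unfolding s_def using has_order_inverse[OF k] .
  obtain h where h: "h analytic_on {z}" "\<forall>\<^sub>F w in at z. s w = h w" "h z = 0"
    using has_order_nonneg_extension[OF s_order] \<open>k < 0\<close> by (metis less_imp_le neg_0_less_iff_less)
  have "\<forall>\<^sub>F w in nhds z. s w = h w"
    using h(2,3) sz by (simp add: eventually_nhds_conv_at)
  hence anl: "s analytic_on {z}"
    using h(1) analytic_at_cong by blast
  \<comment> \<open>A zero of t would also give s the value 0 without being equivalent to the pole;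
    U has to avoid such points.\<close>
  have "\<forall>\<^sub>F w in nhds z. w \<in> uhp \<and> (w \<noteq> z \<longrightarrow> t analytic_on {w} \<and> t w \<noteq> 0)"
    using eventually_analytic[OF assms(1)] eventually_t_neq[OF assms(1), of 0]
      eventually_in_uhp[OF assms(1)]
    unfolding eventually_at_filter by eventually_elim auto
  then obtain U where U: "open U" "z \<in> U"
    "\<And>w. w \<in> U \<Longrightarrow> w \<in> uhp \<and> (w \<noteq> z \<longrightarrow> t analytic_on {w} \<and> t w \<noteq> 0)"
    by (auto simp: eventually_nhds)
  have "stabilizer_order \<Gamma> z = nat (- k)"
  proof (rule stabilizer_order_eq_order[OF countable_group assms(1) anl _ _ _ U(1,2)])
    show "has_order (\<lambda>w. s w - s z) z (int (nat (- k)))"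
      using s_order \<open>k < 0\<close> by (simp add: sz)
    show "\<forall>\<^sub>F w in at z. s (act A w) = s w" if "A \<in> \<Gamma>" for A
      using eventually_analytic[OF assms(1)]
      by eventually_elim (use t_invariant that in \<open>auto simp: s_def\<close>)
    show "equivalent \<Gamma> w w'" if w: "w \<in> U" "w' \<in> U" "s w = s w'" for w w'
    proof -
      have eq: "t w = t w'" using w(3) by (simp add: s_def)
      have "sphere_value t w = sphere_value t w'"
      proof (cases "w = w'")
        case False
        hence "w \<noteq> z" "w' \<noteq> z"
          using U(3) w t_pole_value[OF assms] eq by metis+
        thus ?thesis
          using U(3) w eq by (auto simp: sphere_value_def dest!: analytic_at_imp_no_pole)
      qed auto
      thus ?thesis
        using sphere_value_eq_iff U(3) w by blast
    qed
  qed (use \<open>k < 0\<close> U in auto)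
  thus "stabilizer_order \<Gamma> z > 0" "has_order t z (- int (stabilizer_order \<Gamma> z))"
    using k \<open>k < 0\<close> by auto
qed

lemma stabilizer_order_pos: "z \<in> uhp \<Longrightarrow> stabilizer_order \<Gamma> z > 0"
  using order_at_finite(1) order_at_pole(1) by blast

end

subsection \<open>Meromorphic forms attached to a Hauptmodul\<close>

lemma analytic_on_poly_compose:
  assumes "f analytic_on S"
  shows   "(\<lambda>w. poly p (f w)) analytic_on S"
  by (induction p) (simp_all add: analytic_on_add analytic_on_mult assms)

context hauptmodul_curve
begin

lemma order_deriv_finite:
  assumes "z \<in> uhp" "\<not> is_pole t z"
  shows   "has_order (deriv t) z (int (stabilizer_order \<Gamma> z) - 1)"
proof -
  have "has_order (deriv (\<lambda>w. t w - t z)) z (int (stabilizer_order \<Gamma> z) - 1)"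
    using has_order_deriv[OF order_at_finite(2)[OF assms]] order_at_finite(1)[OF assms] by simp
  moreover have "\<forall>\<^sub>F w in at z. deriv (\<lambda>w. t w - t z) w = deriv t w"
    using eventually_analytic[OF assms(1)]
  proof eventually_elim
    case (elim w)
    hence "t field_differentiable at w"
      using analytic_on_imp_differentiable_at by blast
    thus ?case by simp
  qed
  ultimately show ?thesis by (rule has_order_cong)
qed

lemma order_deriv_pole:
  assumes "z \<in> uhp" "is_pole t z"
  shows   "has_order (deriv t) z (- int (stabilizer_order \<Gamma> z) - 1)"
  using has_order_deriv[OF order_at_pole(2)[OF assms]] order_at_pole(1)[OF assms] by simp

lemma order_poly_finite:
  assumes "z \<in> uhp" "\<not> is_pole t z" "p \<noteq> 0"
  shows   "has_order (\<lambda>w. poly p (t w)) z (int (stabilizer_order \<Gamma> z) * int (Polynomial.order (t z) p))"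
proof -
  define k where "k = Polynomial.order (t z) p"
  obtain q where q: "p = [:- t z, 1:] ^ k * q" "\<not> [:- t z, 1:] dvd q"
    using order_decomp[OF assms(3)] unfolding k_def by blast
  have qz: "poly q (t z) \<noteq> 0"
    using q(2) by (simp add: poly_eq_0_iff_dvd)
  have "t analytic_on {z}" by (rule t_analytic_at) fact+
  hence "(\<lambda>w. poly q (t w)) analytic_on {z}"
    by (rule analytic_on_poly_compose)
  hence "has_order (\<lambda>w. poly q (t w)) z 0"
    using qz by (intro has_order_analytic)
  from has_order_mult[OF has_order_power[OF order_at_finite(2)[OF assms(1,2)], of k] this]
  have "has_order (\<lambda>w. (t w - t z) ^ k * poly q (t w)) z (int (stabilizer_order \<Gamma> z) * int k)"
    by (simp add: mult.commute)
  moreover have "poly p (t w) = (t w - t z) ^ k * poly q (t w)" for w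
    by (subst q(1)) (simp add: poly_mult poly_power)
  ultimately show ?thesis
    by (simp add: k_def)
qed

text \<open>With the reflected polynomial, p(t) is t^(degree p) times a polynomial in 1/t whose
  value at the pole is the leading coefficient of p, which is not 0.\<close>

lemma order_poly_pole:
  assumes "z \<in> uhp" "is_pole t z" "p \<noteq> 0"
  shows   "has_order (\<lambda>w. poly p (t w)) z (- int (stabilizer_order \<Gamma> z) * int (degree p))"
proof -
  have pos: "stabilizer_order \<Gamma> z > 0" and ord: "has_order t z (- int (stabilizer_order \<Gamma> z))"
    using order_at_pole[OF assms(1,2)] by auto
  obtain h where h: "h analytic_on {z}" "\<forall>\<^sub>F w in at z. inverse (t w) = h w" "h z = 0"
    using has_order_nonneg_extension[OF has_order_inverse[OF ord]] pos by (metis int_nat_eq minus_minus of_nat_0_less_iff of_nat_0_le_iff)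
  have "(\<lambda>w. poly (reflect_poly p) (h w)) analytic_on {z}"
    using h(1) by (rule analytic_on_poly_compose)
  hence "has_order (\<lambda>w. poly (reflect_poly p) (h w)) z 0"
    using assms(3) h(3) by (intro has_order_analytic) (auto simp: poly_0_coeff_0)
  from has_order_mult[OF has_order_power[OF ord, of "degree p"] this]
  have "has_order (\<lambda>w. t w ^ degree p * poly (reflect_poly p) (h w)) z
          (- int (stabilizer_order \<Gamma> z) * int (degree p))"
    by (simp add: mult.commute)
  moreover have "\<forall>\<^sub>F w in at z. t w ^ degree p * poly (reflect_poly p) (h w) = poly p (t w)"
    using h(2) has_order_nonzero[OF ord]
  proof eventually_elim
    case (elim w)
    have "poly (reflect_poly p) (inverse (t w)) = inverse (t w) ^ degree p * poly p (t w)"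
      using poly_reflect_poly_nz[of "inverse (t w)" p] elim(2) by simp
    thus ?case
      using elim(2) by (simp add: elim(1)[symmetric] power_inverse)
  qed
  ultimately show ?thesis by (rule has_order_cong)
qed

text \<open>Differentiating t(Az) = t(z) shows that t' behaves like a form of weight 2.\<close>

lemma deriv_t_act:
  assumes "A \<in> \<Gamma>" "z \<in> uhp" "t analytic_on {act A z}"
  shows   "deriv t (act A z) = automorphy_factor A z ^ 2 * deriv t z"
proof -
  have det: "det A = 1" using det_1 assms(1) by blast
  have "(t has_field_derivative deriv t (act A z)) (at (act A z))"
    using assms(3) analytic_on_imp_differentiable_at DERIV_deriv_iff_field_differentiable by blast
  hence "((\<lambda>w. t (act A w)) has_field_derivative deriv t (act A z) * (1 / automorphy_factor A z ^ 2)) (at z)"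
    using has_field_derivative_act[OF det assms(2)] by (rule DERIV_chain2)
  moreover have "\<forall>\<^sub>F w in nhds z. t (act A w) = t w"
    using eventually_in_uhp[OF assms(2)] by eventually_elim (use t_invariant assms(1) in auto)
  ultimately have "(t has_field_derivative deriv t (act A z) * (1 / automorphy_factor A z ^ 2)) (at z)"
    using DERIV_cong_ev[of z z "\<lambda>w. t (act A w)" t] by blast
  hence "deriv t z = deriv t (act A z) / automorphy_factor A z ^ 2"
    by (simp add: DERIV_imp_deriv)
  thus ?thesis
    using automorphy_factor_nonzero[OF det assms(2)] by simp
qed

end

section \<open>Orders of forms in terms of the elliptic points\<close>

locale elliptic_data = hauptmodul_curve +
  fixes r :: nat and \<tau> :: "nat \<Rightarrow> complex" and e :: "nat \<Rightarrow> nat" and a :: "nat \<Rightarrow> complex option"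
  assumes reps: "elliptic_representatives \<Gamma> r \<tau> e"
  assumes a_eq: "\<And>i. i \<in> {1..r} \<Longrightarrow> a i = sphere_value t (\<tau> i)"
begin

definition finite_indices :: "nat set" where
  "finite_indices = {i. i \<in> {1..r} \<and> a i \<noteq> None}"

lemma finite_finite_indices [simp, intro]: "finite finite_indices"
  by (simp add: finite_indices_def)

lemma tau_in_uhp: "i \<in> {1..r} \<Longrightarrow> \<tau> i \<in> uhp"
  and e_ge_2: "i \<in> {1..r} \<Longrightarrow> e i \<ge> 2"
  and e_eq: "i \<in> {1..r} \<Longrightarrow> e i = stabilizer_order \<Gamma> (\<tau> i)"
  using reps by (auto simp: elliptic_representatives_def elliptic_point_def)

lemma inj_on_a: "inj_on a {1..r}"
proof (rule inj_onI)
  fix i j assume ij: "i \<in> {1..r}" "j \<in> {1..r}" "a i = a j"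
  hence "equivalent \<Gamma> (\<tau> i) (\<tau> j)"
    using a_eq sphere_value_eq_iff tau_in_uhp by auto
  moreover have "equivalent \<Gamma> (\<tau> j) (\<tau> j)"
    unfolding equivalent_def by (rule bexI[OF _ one_mem]) simp
  moreover have "elliptic_point \<Gamma> (\<tau> j)"
    using reps ij by (auto simp: elliptic_representatives_def)
  hence "\<exists>!i. i \<in> {1..r} \<and> equivalent \<Gamma> (\<tau> i) (\<tau> j)"
    using reps unfolding elliptic_representatives_def by blast
  ultimately show "i = j" using ij by blast
qed

text \<open>Instead of conjugating stabilizers, the orders of t at the two points are compared;
  composition with an element of \<Gamma> preserves them.\<close>

lemma stabilizer_order_elliptic:
  assumes "z \<in> uhp" "i \<in> {1..r}" "a i = sphere_value t z"
  shows   "stabilizer_order \<Gamma> z = e i"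
proof -
  have \<tau>: "\<tau> i \<in> uhp" using assms tau_in_uhp by auto
  have sv: "sphere_value t (\<tau> i) = sphere_value t z"
    using assms a_eq by auto
  then obtain A where A: "A \<in> \<Gamma>" "z = act A (\<tau> i)"
    using sphere_value_eq_iff[OF \<tau> assms(1)] by (auto simp: equivalent_def)
  have det: "det A = 1" using det_1 A by blast
  have ev: "\<forall>\<^sub>F w in at (\<tau> i). t (act A w) = t w"
    using eventually_analytic[OF \<tau>] by eventually_elim (use t_invariant A(1) in auto)
  show ?thesis
  proof (cases "is_pole t z")
    case True
    hence pole: "is_pole t (\<tau> i)" using sv by (auto simp: sphere_value_def split: if_splits)
    have "has_order (\<lambda>w. t (act A w)) (\<tau> i) (- int (stabilizer_order \<Gamma> z))"
      using has_order_compose_act[OF det \<tau>] order_at_pole(2)[OF assms(1) True] A(2) by blast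
    hence "has_order t (\<tau> i) (- int (stabilizer_order \<Gamma> z))"
      using ev by (rule has_order_cong)
    from has_order_unique[OF this order_at_pole(2)[OF \<tau> pole]] show ?thesis
      using e_eq assms(2) by simp
  next
    case False
    hence nopole: "\<not> is_pole t (\<tau> i)" and eq: "t z = t (\<tau> i)"
      using sv by (auto simp: sphere_value_def split: if_splits)
    have "has_order (\<lambda>w. t (act A w) - t z) (\<tau> i) (int (stabilizer_order \<Gamma> z))"
      using has_order_compose_act[OF det \<tau>, of "\<lambda>w. t w - t z"]
        order_at_finite(2)[OF assms(1) False] A(2) by simp
    hence "has_order (\<lambda>w. t w - t (\<tau> i)) (\<tau> i) (int (stabilizer_order \<Gamma> z))"
    proof (rule has_order_cong)
      show "\<forall>\<^sub>F w in at (\<tau> i). t (act A w) - t z = t w - t (\<tau> i)"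
        using ev by eventually_elim (simp add: eq)
    qed
    from has_order_unique[OF this order_at_finite(2)[OF \<tau> nopole]] show ?thesis
      using e_eq assms(2) by simp
  qed
qed

lemma stabilizer_order_not_elliptic:
  assumes "z \<in> uhp" "\<And>i. i \<in> {1..r} \<Longrightarrow> a i \<noteq> sphere_value t z"
  shows   "stabilizer_order \<Gamma> z = 1"
proof (rule ccontr)
  assume "stabilizer_order \<Gamma> z \<noteq> 1"
  hence "elliptic_point \<Gamma> z"
    using stabilizer_order_pos[OF assms(1)] assms(1) by (simp add: elliptic_point_def)
  then obtain i where "i \<in> {1..r}" "equivalent \<Gamma> (\<tau> i) z"
    using reps unfolding elliptic_representatives_def by blast
  thus False
    using sphere_value_eq_iff[of "\<tau> i" z] a_eq assms tau_in_uhp by metis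
qed

text \<open>By \<open>inj_on_a\<close> at most one representative lies over a given value. The
  condition f 1 = 0 makes the empty sum at a non-elliptic point agree with the right-hand
  side.\<close>

lemma sum_over_value:
  assumes "z \<in> uhp" "f 1 = (0::int)"
  shows   "(\<Sum>i | i \<in> {1..r} \<and> a i = sphere_value t z. f (e i)) = f (stabilizer_order \<Gamma> z)"
proof (cases "\<exists>i\<in>{1..r}. a i = sphere_value t z")
  case True
  then obtain i where i: "i \<in> {1..r}" "a i = sphere_value t z" by blast
  have "j = i" if "j \<in> {1..r}" "a j = sphere_value t z" for j
    using inj_onD[OF inj_on_a, of j i] that i by metis
  hence "{i. i \<in> {1..r} \<and> a i = sphere_value t z} = {i}"
    using i by blast
  hence "(\<Sum>i | i \<in> {1..r} \<and> a i = sphere_value t z. f (e i)) = f (e i)"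
    by (simp only:) simp
  thus ?thesis
    using stabilizer_order_elliptic[OF assms(1) i] by (simp only:)
next
  case False
  hence "{i. i \<in> {1..r} \<and> a i = sphere_value t z} = {}" by blast
  hence "(\<Sum>i | i \<in> {1..r} \<and> a i = sphere_value t z. f (e i)) = 0"
    by (simp only:) simp
  moreover have "stabilizer_order \<Gamma> z = 1"
    using False by (intro stabilizer_order_not_elliptic[OF assms(1)]) blast
  ultimately show ?thesis
    using assms(2) by (simp only:)
qed

text \<open>The indices left out are those over infinity, at most one; if the pole is not elliptic,
  the subtracted term is f 1 = 0.\<close>

lemma sum_finite_indices_eq:
  assumes "z \<in> uhp" "is_pole t z" "f 1 = (0::int)"
  shows   "(\<Sum>i\<in>finite_indices. f (e i)) = (\<Sum>i=1..r. f (e i)) - f (stabilizer_order \<Gamma> z)"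
proof -
  define E where "E = {i. i \<in> {1..r} \<and> a i = sphere_value t z}"
  have "sum (\<lambda>i. f (e i)) (finite_indices \<union> E) =
          (\<Sum>i\<in>finite_indices. f (e i)) + (\<Sum>i\<in>E. f (e i))"
    using assms(2) by (intro sum.union_disjoint) (auto simp: E_def finite_indices_def sphere_value_def)
  moreover have "finite_indices \<union> E = {1..r}"
    using assms(2) by (auto simp: E_def finite_indices_def sphere_value_def)
  moreover have "(\<Sum>i\<in>E. f (e i)) = f (stabilizer_order \<Gamma> z)"
    unfolding E_def using assms by (intro sum_over_value)
  ultimately show ?thesis
    by simp
qed

text \<open>The exponents depend on i only through e i, so that orders can be written in terms of
  the stabilizer order alone. The uses are M = m for the basis, M = 0 for the product by itself, and
  M = -N for a form of negative weight.\<close>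

definition meromorphic_form :: "int \<Rightarrow> (nat \<Rightarrow> int) \<Rightarrow> complex poly \<Rightarrow> complex \<Rightarrow> complex" where
  "meromorphic_form M c p z = deriv t z powi M * poly p (t z) *
     (\<Prod>i\<in>finite_indices. (t z - the (a i)) powi c (e i))"

text \<open>Only a factor with a i = t z contributes to the order at z, and
  \<open>sum_over_value\<close> turns its share into n * c n.\<close>

lemma meromorphic_form_order_finite:
  assumes "z \<in> uhp" "\<not> is_pole t z" "p \<noteq> 0" "c 1 = 0"
  defines "n \<equiv> stabilizer_order \<Gamma> z"
  shows   "has_order (meromorphic_form M c p) z
             (M * (int n - 1) + int n * (int (Polynomial.order (t z) p) + c n))"
proof -
  define ord where "ord = (\<lambda>i. if a i = sphere_value t z then int n else 0)"
  have *: "has_order (\<lambda>w. (t w - the (a i)) powi c (e i)) z (c (e i) * ord i)"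
    if "i \<in> finite_indices" for i
  proof (rule has_order_powi)
    show "has_order (\<lambda>w. t w - the (a i)) z (ord i)"
    proof (cases "a i = sphere_value t z")
      case True
      hence "the (a i) = t z" using assms(2) by (simp add: sphere_value_def)
      thus ?thesis
        using order_at_finite(2)[OF assms(1,2)] True by (simp add: ord_def n_def)
    next
      case False
      have "(\<lambda>w. t w - the (a i)) analytic_on {z}"
        using t_analytic_at[OF assms(1,2)] by (intro analytic_intros)
      moreover have "t z - the (a i) \<noteq> 0"
        using False that assms(2) by (auto simp: sphere_value_def finite_indices_def)
      ultimately show ?thesis
        using False has_order_analytic by (simp add: ord_def)
    qed
  qed
  have "has_order (meromorphic_form M c p) z
      (M * (int n - 1) + int n * int (Polynomial.order (t z) p) + (\<Sum>i\<in>finite_indices. c (e i) * ord i))"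
    unfolding meromorphic_form_def n_def
    by (rule has_order_mult[OF has_order_mult[OF has_order_powi[OF order_deriv_finite[OF assms(1,2)]]
          order_poly_finite[OF assms(1-3)]] has_order_prod[OF *]])
  also have "(\<Sum>i\<in>finite_indices. c (e i) * ord i) =
      (\<Sum>i | i \<in> {1..r} \<and> a i = sphere_value t z. c (e i) * int n)"
    by (rule sum.mono_neutral_cong_right)
       (use assms(2) in \<open>auto simp: finite_indices_def ord_def sphere_value_def\<close>)
  also have "\<dots> = int n * c n"
    using sum_over_value[OF assms(1), of c] assms(4)
    by (simp only: n_def sum_distrib_right[symmetric] mult.commute)
  finally show ?thesis
    by (simp add: algebra_simps)
qed

text \<open>Each t - a i has a pole of order n here. An elliptic point over infinity has no factor
  in the product, which is why c n is taken off the full sum.\<close>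

lemma meromorphic_form_order_pole:
  assumes "z \<in> uhp" "is_pole t z" "p \<noteq> 0" "c 1 = 0"
  defines "n \<equiv> stabilizer_order \<Gamma> z"
  shows   "has_order (meromorphic_form M c p) z
             (- M * (int n + 1) - int n * (int (degree p) + (\<Sum>i=1..r. c (e i)) - c n))"
proof -
  have *: "has_order (\<lambda>w. (t w - the (a i)) powi c (e i)) z (c (e i) * (- int n))" for i
    using has_order_powi[OF order_poly_pole[OF assms(1,2), of "[:- the (a i), 1:]"]]
    by (simp add: n_def)
  have "has_order (meromorphic_form M c p) z
      (M * (- int n - 1) + (- int n) * int (degree p) + (\<Sum>i\<in>finite_indices. c (e i) * (- int n)))"
    unfolding meromorphic_form_def n_def
    by (rule has_order_mult[OF has_order_mult[OF has_order_powi[OF order_deriv_pole[OF assms(1,2)]]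
          order_poly_pole[OF assms(1-3)]] has_order_prod[OF * [unfolded n_def]]])
  also have "(\<Sum>i\<in>finite_indices. c (e i) * (- int n)) = - int n * (\<Sum>i\<in>finite_indices. c (e i))"
    unfolding sum_distrib_left by (rule sum.cong[OF refl mult.commute])
  also have "(\<Sum>i\<in>finite_indices. c (e i)) = (\<Sum>i=1..r. c (e i)) - c n"
    unfolding n_def using assms(1,2,4) by (rule sum_finite_indices_eq)
  finally show ?thesis
    by (simp add: algebra_simps)
qed

lemma meromorphic_form_transform:
  assumes "A \<in> \<Gamma>" "z \<in> uhp"
  shows   "\<forall>\<^sub>F w in at z. meromorphic_form M c p (act A w) =
             automorphy_factor A w powi (2 * M) * meromorphic_form M c p w"
proof -
  have det: "det A = 1" using det_1 assms(1) by blast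
  show ?thesis
    using eventually_analytic[OF assms(2)]
      eventually_at_act[OF det assms(2) eventually_analytic[OF act_mem_uhp[OF assms]]]
  proof eventually_elim
    case (elim w)
    have t: "t (act A w) = t w"
      using elim t_invariant[OF assms(1)] by blast
    have d: "deriv t (act A w) = automorphy_factor A w ^ 2 * deriv t w"
      using elim deriv_t_act[OF assms(1)] by blast
    have "(automorphy_factor A w ^ 2) powi M = automorphy_factor A w powi (2 * M)"
      using power_int_mult[of "automorphy_factor A w" 2 M] by simp
    thus ?case
      unfolding meromorphic_form_def t d by (simp only: power_int_mult_distrib mult.assoc)
  qed
qed

text \<open>The raw expression may violate its transformation law at the singularities. Both sides
  of the law for f are analytic and agree near z, hence also at z.\<close>

lemma on_uhp_transform:
  assumes "f analytic_on uhp" "\<And>z. z \<in> uhp \<Longrightarrow> \<forall>\<^sub>F w in at z. meromorphic_form M c p w = f w"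
    and "A \<in> \<Gamma>" "z \<in> uhp"
  shows   "f (act A z) = automorphy_factor A z powi (2 * M) * f z"
proof -
  have det: "det A = 1" using det_1 assms by blast
  have anl: "f analytic_on {z}" if "z \<in> uhp" for z
    using assms(1) by (rule analytic_on_subset) (use that in auto)
  have "f \<circ> act A analytic_on {z}"
  proof (rule analytic_on_compose)
    show "act A analytic_on {z}"
      using analytic_act[OF det] by (rule analytic_on_subset) (use assms in auto)
    show "f analytic_on act A ` {z}"
      using anl act_mem_uhp assms by auto
  qed
  moreover have "(\<lambda>w. automorphy_factor A w powi (2 * M) * f w) analytic_on {z}"
    using anl[OF assms(4)] automorphy_factor_nonzero[OF det assms(4)]
    by (intro analytic_on_mult analytic_on_power_int analytic_automorphy_factor) auto
  moreover have "\<forall>\<^sub>F w in at z. (f \<circ> act A) w = automorphy_factor A w powi (2 * M) * f w"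
    using meromorphic_form_transform[OF assms(3,4), of M c p] assms(2)[OF assms(4)]
      eventually_at_act[OF det assms(4) assms(2)[OF act_mem_uhp[OF assms(3,4)]]]
    by eventually_elim (simp only: o_def)
  ultimately have "(f \<circ> act A) z = automorphy_factor A z powi (2 * M) * f z"
    by (rule analytic_eq_of_eventually_eq)
  thus ?thesis by simp
qed

end

subsection \<open>Hyperbolicity of the signature\<close>

context hauptmodul_curve
begin

text \<open>An invariant continuous function descends through the quotient map to the sphere, whose
  compactness provides the maximum.\<close>

lemma invariant_attains_sup:
  fixes f :: "complex \<Rightarrow> real"
  assumes "continuous_on uhp f" "\<And>A z. A \<in> \<Gamma> \<Longrightarrow> z \<in> uhp \<Longrightarrow> f (act A z) = f z"
  obtains z where "z \<in> uhp" "\<And>w. w \<in> uhp \<Longrightarrow> f w \<le> f z"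
proof -
  let ?Y = "Alexandroff_compactification (euclidean :: complex topology)"
  have inv: "f z = f w" if "z \<in> uhp" "w \<in> uhp" "sphere_value t z = sphere_value t w" for z w
    using sphere_value_eq_iff[of z w] that assms(2) by (auto simp: equivalent_def)
  have "continuous_map (top_of_set uhp) euclideanreal f"
    using assms(1) by simp
  from quotient_map_lift_exists[OF quotient_map_t this] inv
  obtain g where g: "continuous_map ?Y euclideanreal g" "g ` topspace ?Y = f ` uhp"
    unfolding topspace_euclidean_subtopology by metis
  have "compactin ?Y (topspace ?Y)"
    using compact_space_Alexandroff_compactification[of euclidean] unfolding compact_space_def .
  hence "compactin euclideanreal (g ` topspace ?Y)"
    using g(1) by (rule image_compactin)
  hence "compact (f ` uhp)"
    by (simp only: g(2) compactin_euclidean_iff)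
  moreover have "f ` uhp \<noteq> {}"
    using i_in_uhp by blast
  ultimately obtain y where "y \<in> f ` uhp" "\<forall>x\<in>f ` uhp. x \<le> y"
    using compact_attains_sup by blast
  thus ?thesis
    using that by blast
qed

text \<open>With \<open>y = Im z\<close>, the function \<open>|F| / y\<^sup>N\<close> is invariant, so it has a maximum, at \<open>z\<^sub>0\<close> say. As
  \<open>4 y y\<^sub>0 \<le> |z - cnj z\<^sub>0|\<^sup>2\<close> with equality only at \<open>z\<^sub>0\<close>, the function \<open>F / (z - cnj z\<^sub>0)\<^sup>2\<^sup>N\<close> would
  have a strict maximum modulus at \<open>z\<^sub>0\<close>.\<close>

lemma negative_weight_eq_0:
  assumes F: "F holomorphic_on uhp" and "N > 0"
    and transform: "\<And>A z. A \<in> \<Gamma> \<Longrightarrow> z \<in> uhp \<Longrightarrow>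
      F (act A z) = automorphy_factor A z powi (- 2 * int N) * F z"
    and "w \<in> uhp"
  shows "F w = 0"
proof (rule ccontr)
  assume "F w \<noteq> 0"
  define \<Phi> where "\<Phi> = (\<lambda>z. cmod (F z) / Im z ^ N)"
  have "continuous_on uhp \<Phi>"
    unfolding \<Phi>_def using holomorphic_on_imp_continuous_on[OF F]
    by (intro continuous_intros) (auto simp: uhp_def)
  moreover have "\<Phi> (act A z) = \<Phi> z" if A: "A \<in> \<Gamma>" and z: "z \<in> uhp" for A z
  proof -
    define j where "j = cmod (automorphy_factor A z)"
    have j: "j > 0"
      using automorphy_factor_nonzero[OF det_1[OF A] z] by (simp add: j_def)
    have "cmod (F (act A z)) = j powi (- (2 * int N)) * cmod (F z)"
      by (simp add: transform[OF A z] norm_mult norm_power_int j_def)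
    also have "j powi (- (2 * int N)) = inverse ((j ^ 2) ^ N)"
      using power_int_of_nat[of j "2 * N"] by (simp add: power_int_minus power_mult)
    finally have "cmod (F (act A z)) = cmod (F z) / (j ^ 2) ^ N"
      by (simp add: divide_inverse mult.commute)
    moreover have "Im (act A z) ^ N = Im z ^ N / (j ^ 2) ^ N"
      by (simp add: Im_act[OF det_1[OF A] z] j_def power_divide)
    ultimately show ?thesis
      using j by (simp add: \<Phi>_def)
  qed
  ultimately obtain z0 where z0: "z0 \<in> uhp" "\<And>z. z \<in> uhp \<Longrightarrow> \<Phi> z \<le> \<Phi> z0"
    using invariant_attains_sup by blast
  define y0 where "y0 = Im z0"
  have y0: "y0 > 0" using z0(1) by (simp add: y0_def uhp_def)
  have "\<Phi> w > 0"
    using \<open>F w \<noteq> 0\<close> assms(4) by (simp add: \<Phi>_def uhp_def)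
  hence pos: "\<Phi> z0 > 0" using z0(2)[OF assms(4)] by linarith
  define K where "K = (\<lambda>z. F z / (z - cnj z0) ^ (2 * N))"
  have norm_K: "cmod (K z) = \<Phi> z * (Im z / (cmod (z - cnj z0)) ^ 2) ^ N" if "z \<in> uhp" for z
    using that by (simp add: K_def \<Phi>_def norm_divide norm_power power_divide power_mult uhp_def)
  have dist: "cmod (z - cnj z0) ^ 2 = (Re z - Re z0) ^ 2 + (Im z - y0) ^ 2 + 4 * (Im z * y0)" for z
    unfolding cmod_power2 by (simp add: y0_def power2_eq_square algebra_simps)
  have nz: "cmod (z - cnj z0) ^ 2 > 0" if "z \<in> uhp" for z
    unfolding dist using that y0
    by (intro add_nonneg_pos add_nonneg_nonneg) (auto simp: uhp_def)
  have ratio: "Im z / cmod (z - cnj z0) ^ 2 \<le> 1 / (4 * y0)" if "z \<in> uhp" for z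
  proof -
    have "Im z * (4 * y0) \<le> cmod (z - cnj z0) ^ 2"
      unfolding dist by simp
    hence "Im z \<le> cmod (z - cnj z0) ^ 2 / (4 * y0)"
      using y0 by (simp only: pos_le_divide_eq)
    thus ?thesis
      unfolding pos_divide_le_eq[OF nz[OF that]] by simp
  qed
  have ratio_strict: "Im z / cmod (z - cnj z0) ^ 2 < 1 / (4 * y0)" if "z \<in> uhp" "z \<noteq> z0" for z
  proof -
    have "Re z - Re z0 \<noteq> 0 \<or> Im z - y0 \<noteq> 0"
      using that(2) by (auto simp: complex_eq_iff y0_def)
    hence "(Re z - Re z0) ^ 2 + (Im z - y0) ^ 2 > 0"
      by (simp add: sum_power2_gt_zero_iff)
    hence "Im z * (4 * y0) < cmod (z - cnj z0) ^ 2"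
      unfolding dist by simp
    hence "Im z < cmod (z - cnj z0) ^ 2 / (4 * y0)"
      using y0 by (simp only: pos_less_divide_eq)
    thus ?thesis
      unfolding pos_divide_less_eq[OF nz[OF that(1)]] by simp
  qed
  have nonneg: "Im z / cmod (z - cnj z0) ^ 2 \<ge> 0" if "z \<in> uhp" for z
    using that by (simp add: uhp_def)
  have "Im z0 / cmod (z0 - cnj z0) ^ 2 = 1 / (4 * y0)"
    using y0 unfolding dist by (simp add: y0_def)
  hence K0: "cmod (K z0) = \<Phi> z0 * (1 / (4 * y0)) ^ N"
    using norm_K[OF z0(1)] by simp
  have strict: "cmod (K z) < cmod (K z0)" if z: "z \<in> uhp" "z \<noteq> z0" for z
  proof -
    have "cmod (K z) \<le> \<Phi> z0 * (Im z / cmod (z - cnj z0) ^ 2) ^ N"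
      unfolding norm_K[OF z(1)] using z0(2)[OF z(1)] nonneg[OF z(1)]
      by (intro mult_right_mono zero_le_power)
    also have "\<dots> < \<Phi> z0 * (1 / (4 * y0)) ^ N"
      using ratio_strict[OF z] nonneg[OF z(1)] pos \<open>N > 0\<close>
      by (intro mult_strict_left_mono power_strict_mono) auto
    finally show ?thesis by (simp add: K0)
  qed
  have "(z - cnj z0) ^ (2 * N) \<noteq> 0" if "z \<in> uhp" for z
    using nz[OF that] by auto
  hence "K holomorphic_on uhp"
    unfolding K_def using F by (intro holomorphic_intros)
  hence "K constant_on uhp"
  proof (rule maximum_modulus_principle[OF _ open_uhp connected_uhp open_uhp subset_refl z0(1)])
    show "cmod (K z) \<le> cmod (K z0)" if "z \<in> uhp" for z
      using strict[OF that] by (cases "z = z0") auto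
  qed
  moreover have "z0 + \<i> \<in> uhp" "z0 + \<i> \<noteq> z0"
    using y0 by (auto simp: uhp_def y0_def)
  ultimately show False
    using strict[of "z0 + \<i>"] z0(1) unfolding constant_on_def by (metis less_irrefl)
qed

end

context elliptic_data
begin

text \<open>The two numerical conditions say that the orders computed above are nonnegative, so all
  singularities in the half-plane are removable.\<close>

lemma meromorphic_form_extends:
  assumes p: "p \<noteq> 0" and c: "c 1 = 0"
    and fin: "\<And>z. z \<in> uhp \<Longrightarrow> \<not> is_pole t z \<Longrightarrow>
      M * (int (stabilizer_order \<Gamma> z) - 1) +
      int (stabilizer_order \<Gamma> z) * (int (Polynomial.order (t z) p) + c (stabilizer_order \<Gamma> z)) \<ge> 0"
    and pole: "\<And>z. z \<in> uhp \<Longrightarrow> is_pole t z \<Longrightarrow>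
      - M * (int (stabilizer_order \<Gamma> z) + 1) -
      int (stabilizer_order \<Gamma> z) * (int (degree p) + (\<Sum>i=1..r. c (e i)) - c (stabilizer_order \<Gamma> z)) \<ge> 0"
  shows "remove_sings (meromorphic_form M c p) analytic_on uhp"
    and "z \<in> uhp \<Longrightarrow> \<forall>\<^sub>F w in at z. meromorphic_form M c p w = remove_sings (meromorphic_form M c p) w"
proof -
  have *: "\<exists>n\<ge>0. has_order (meromorphic_form M c p) z n" if "z \<in> uhp" for z
  proof (cases "is_pole t z")
    case True
    show ?thesis
      by (rule exI, rule conjI[OF pole[OF that True]])
         (rule meromorphic_form_order_pole[where c = c and M = M and p = p, OF that True p c])
  next
    case False
    show ?thesis
      by (rule exI, rule conjI[OF fin[OF that False]])
         (rule meromorphic_form_order_finite[where c = c and M = M and p = p, OF that False p c])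
  qed
  have ext: "remove_sings (meromorphic_form M c p) analytic_on {z} \<and>
      (\<forall>\<^sub>F w in at z. meromorphic_form M c p w = remove_sings (meromorphic_form M c p) w)"
    if "z \<in> uhp" for z
  proof -
    from *[OF that] obtain n where n: "has_order (meromorphic_form M c p) z n" "n \<ge> 0"
      by blast
    show ?thesis
      using has_order_nonneg_remove_sings(1,3)[OF n] by (rule conjI)
  qed
  show "remove_sings (meromorphic_form M c p) analytic_on uhp"
    using ext by (subst analytic_on_analytic_at) blast
  show "\<forall>\<^sub>F w in at z. meromorphic_form M c p w = remove_sings (meromorphic_form M c p) w"
    if "z \<in> uhp" for z
    using ext[OF that] by (rule conjunct2)
qed

text \<open>Makes N (1 - 1/n) an integer for every stabilizer order n with one and the same
  N.\<close>

lemma stabilizer_order_dvd_prod: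
  assumes "z \<in> uhp"
  shows   "stabilizer_order \<Gamma> z dvd (\<Prod>i=1..r. e i)"
proof (cases "\<exists>i\<in>{1..r}. a i = sphere_value t z")
  case True
  then obtain i where "i \<in> {1..r}" "a i = sphere_value t z" by blast
  thus ?thesis
    using stabilizer_order_elliptic[OF assms] by (metis dvd_prodI finite_atLeastAtMost)
next
  case False
  hence "stabilizer_order \<Gamma> z = 1"
    by (intro stabilizer_order_not_elliptic[OF assms]) blast
  thus ?thesis by simp
qed

text \<open>Otherwise a suitable power of \<open>t'\<close>, corrected at the elliptic points, would be the inverse of a
  nonzero holomorphic form of negative weight.\<close>

lemma hyperbolic: "(\<Sum>i=1..r. 1 - 1 / real (e i)) > 2"
proof (rule ccontr)
  assume *: "\<not> ?thesis"
  define N where "N = (\<Prod>i=1..r. e i)"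
  \<comment> \<open>c n = N (1 - 1/n) is chosen so that n * c n cancels the order -N (n - 1) of the
    (-N)-th power of t' at a finite point.\<close>
  define c where "c = (\<lambda>n. int (N div n * (n - 1)))"
  have e_pos: "e i > 0" if "i \<in> {1..r}" for i
    using e_ge_2[OF that] by simp
  have "N > 0"
    unfolding N_def using e_pos by (intro prod_pos) auto
  have c1: "c 1 = 0" by (simp add: c_def)
  have c_eq: "int n * c n = int N * (int n - 1)" if "n dvd N" "n > 0" for n
  proof -
    obtain k where k: "N = n * k"
      using \<open>n dvd N\<close> by blast
    hence "N div n = k"
      using \<open>n > 0\<close> by simp
    thus ?thesis
      using \<open>n > 0\<close> by (simp add: c_def k of_nat_diff)
  qed
  have "real_of_int (\<Sum>i=1..r. c (e i)) = (\<Sum>i=1..r. real N * (1 - 1 / real (e i)))"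
    unfolding of_int_sum
  proof (rule sum.cong)
    fix i assume i: "i \<in> {1..r}"
    have d: "e i dvd N"
      unfolding N_def using i by (intro dvd_prodI) auto
    hence "real_of_int (int (e i) * c (e i)) = real_of_int (int N * (int (e i) - 1))"
      by (simp only: c_eq[OF d e_pos[OF i]])
    thus "real_of_int (c (e i)) = real N * (1 - 1 / real (e i))"
      using e_pos[OF i] by (simp add: field_simps)
  qed auto
  also have "\<dots> = real N * (\<Sum>i=1..r. 1 - 1 / real (e i))"
    by (simp add: sum_distrib_left)
  also have "\<dots> \<le> real N * 2"
    using * by (intro mult_left_mono) auto
  finally have sum_c: "(\<Sum>i=1..r. c (e i)) \<le> 2 * int N"
    by linarith
  define M where "M = - int N"
  have c_stab: "int n * c n = int N * (int n - 1)" if "z \<in> uhp" "n = stabilizer_order \<Gamma> z" for z n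
    unfolding that(2) N_def
    by (rule c_eq[unfolded N_def, OF stabilizer_order_dvd_prod[OF that(1)] stabilizer_order_pos[OF that(1)]])
  have fin: "M * (int n - 1) + int n * (int (Polynomial.order (t z) 1) + c n) = 0"
    if "z \<in> uhp" "n = stabilizer_order \<Gamma> z" for z n
    using c_stab[OF that] by (simp add: M_def)
  \<comment> \<open>At a pole the order is n times 2 N minus the sum of the c (e i); the negated
    claim says that this is nonnegative.\<close>
  have pole: "- M * (int n + 1) - int n * (int (degree (1 :: complex poly)) + (\<Sum>i=1..r. c (e i)) - c n) \<ge> 0"
    if "z \<in> uhp" "n = stabilizer_order \<Gamma> z" for z n
  proof -
    have "- M * (int n + 1) - int n * (int (degree (1 :: complex poly)) + (\<Sum>i=1..r. c (e i)) - c n) =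
            int n * (2 * int N - (\<Sum>i=1..r. c (e i)))"
    proof -
      have "- M * (int n + 1) - int n * (int (degree (1 :: complex poly)) + S - c n) =
              int N * (int n + 1) - int n * S + int n * c n" for S
        by (simp add: M_def right_diff_distrib)
      thus ?thesis
        unfolding c_stab[OF that] by (simp add: algebra_simps)
    qed
    also have "\<dots> \<ge> 0"
      using sum_c by (intro mult_nonneg_nonneg) auto
    finally show ?thesis .
  qed
  define F where "F = remove_sings (meromorphic_form M c 1)"
  have F: "F analytic_on uhp" "\<And>z. z \<in> uhp \<Longrightarrow> \<forall>\<^sub>F w in at z. meromorphic_form M c 1 w = F w"
    unfolding F_def
    using meromorphic_form_extends[where p = 1 and c = c and M = M, OF one_neq_zero c1
        eq_refl[OF fin[OF _ refl, symmetric]] pole[OF _ refl]] by blast+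
  \<comment> \<open>The order is 0 at every finite point; a zero of t is merely a convenient
    one.\<close>
  obtain z where z: "z \<in> uhp" "sphere_value t z = Some 0"
    by (rule sphere_value_surj)
  have "\<not> is_pole t z"
    using z(2) by (auto simp: sphere_value_def)
  from meromorphic_form_order_finite[where c = c and M = M and p = 1, OF z(1) this _ c1] fin[OF z(1) refl]
  have "has_order (meromorphic_form M c 1) z 0" by simp
  hence "F z \<noteq> 0"
    using has_order_nonneg_remove_sings(2) unfolding F_def by blast
  moreover have "F z = 0"
  proof (rule negative_weight_eq_0[OF _ \<open>N > 0\<close> _ z(1)])
    show "F holomorphic_on uhp"
      using F(1) by (rule analytic_imp_holomorphic)
    show "F (act A z) = automorphy_factor A z powi (- 2 * int N) * F z"
      if "A \<in> \<Gamma>" "z \<in> uhp" for A z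
      using on_uhp_transform[OF F that] by (simp add: M_def)
  qed
  ultimately show False by blast
qed

end

subsection \<open>The expected dimension\<close>

text \<open>A nonconstant q has a root, which is a root of p as well; cancelling the linear factor
  from both lowers the degree of q and preserves the hypothesis.\<close>

lemma complex_poly_dvd_of_order_le:
  fixes p q :: "complex poly"
  assumes "p \<noteq> 0" "q \<noteq> 0" "\<And>x. Polynomial.order x q \<le> Polynomial.order x p"
  shows   "q dvd p"
  using assms
proof (induction "degree q" arbitrary: p q)
  case 0
  hence "q dvd 1"
    by (simp add: is_unit_iff_degree)
  thus ?case
    by (rule dvd_trans) simp
next
  case (Suc n)
  hence "\<not> constant (poly q)"
    using constant_degree[of q] by simp
  then obtain x where x: "poly q x = 0"
    using fundamental_theorem_of_algebra by blast
  hence "Polynomial.order x q \<noteq> 0"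
    using Suc.prems(2) by (simp add: order_root)
  hence "Polynomial.order x p \<noteq> 0"
    using Suc.prems(3)[of x] by simp
  hence "poly p x = 0"
    by (simp add: order_root)
  obtain p' q' where pq: "p = [:-x, 1:] * p'" "q = [:-x, 1:] * q'"
    using x \<open>poly p x = 0\<close> by (auto simp: poly_eq_0_iff_dvd elim!: dvdE)
  have nz: "p' \<noteq> 0" "q' \<noteq> 0"
    using Suc.prems(1,2) pq by auto
  have "degree q = Suc (degree q')"
    unfolding pq(2) using nz by (subst degree_mult_eq) auto
  hence "n = degree q'"
    using Suc.hyps(2) by simp
  moreover have "Polynomial.order y q' \<le> Polynomial.order y p'" for y
    using Suc.prems(3)[of y] order_mult[OF Suc.prems(1)[unfolded pq(1)], of y]
      order_mult[OF Suc.prems(2)[unfolded pq(2)], of y]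
    unfolding pq by linarith
  ultimately have "q' dvd p'"
    using Suc.hyps(1) nz by blast
  thus ?case
    unfolding pq by (rule mult_dvd_mono[OF dvd_refl])
qed

text \<open>This is \<lfloor>m (1 - 1/n)\<rfloor>, expressed by division of natural numbers so that
  the estimates stay within the integers.\<close>

definition elliptic_floor :: "nat \<Rightarrow> nat \<Rightarrow> int" where
  "elliptic_floor m n = int (m * (n - 1) div n)"

lemma floor_eq_elliptic_floor:
  assumes "n > 0"
  shows   "\<lfloor>real m * (1 - 1 / real n)\<rfloor> = elliptic_floor m n"
proof -
  have "real m * (1 - 1 / real n) = real (m * (n - 1)) / real n"
    using assms by (simp add: field_simps of_nat_diff)
  thus ?thesis
    unfolding elliptic_floor_def by (simp only: floor_divide_of_nat_eq)
qed

lemma elliptic_floor_1: "elliptic_floor m 1 = 0"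
  by (simp add: elliptic_floor_def)

lemma elliptic_floor_nonneg: "elliptic_floor m n \<ge> 0"
  by (simp add: elliptic_floor_def)

lemma elliptic_floor_bounds:
  assumes "n > 0"
  shows   "int n * elliptic_floor m n \<le> int m * (int n - 1)"
    and   "int m * (int n - 1) < int n * (elliptic_floor m n + 1)"
proof -
  define x y where "x = m * (n - 1)" and "y = x div n"
  have x: "int x = int m * (int n - 1)"
    using assms by (simp add: x_def of_nat_diff)
  have "n * y \<le> x" "x < n * (y + 1)"
    using assms by (simp_all add: y_def dividend_less_times_div)
  hence "int (n * y) \<le> int x" "int x < int (n * (y + 1))"
    by (simp_all only: of_nat_le_iff of_nat_less_iff)
  thus "int n * elliptic_floor m n \<le> int m * (int n - 1)"
    "int m * (int n - 1) < int n * (elliptic_floor m n + 1)"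
    unfolding x elliptic_floor_def x_def[symmetric] y_def[symmetric] by (simp_all add: distrib_left)
qed

text \<open>The ceiling of -m (n - 1)/n is \<open>- elliptic_floor m n\<close>. The conditions for
  holomorphy at finite points and at poles both take the form on the right, with different
  x.\<close>

lemma minus_elliptic_floor_le_iff:
  assumes "n > 0"
  shows   "- elliptic_floor m n \<le> x \<longleftrightarrow> 0 \<le> int m * (int n - 1) + int n * x"
proof
  assume "- elliptic_floor m n \<le> x"
  hence "int n * (- elliptic_floor m n) \<le> int n * x"
    by (intro mult_left_mono) auto
  thus "0 \<le> int m * (int n - 1) + int n * x"
    using elliptic_floor_bounds(1)[OF assms, of m] by simp
next
  assume "0 \<le> int m * (int n - 1) + int n * x"
  hence "int n * (- x) < int n * (elliptic_floor m n + 1)"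
    using elliptic_floor_bounds(2)[OF assms, of m] by simp
  hence "- x < elliptic_floor m n + 1"
    using assms by (simp only: mult_less_cancel_left_pos of_nat_0_less_iff)
  thus "- elliptic_floor m n \<le> x" by linarith
qed

context elliptic_data
begin

text \<open>The estimate \<lfloor>m (1 - 1/n)\<rfloor> \<ge> (m - 1)(1 - 1/n) and
  \<open>hyperbolic\<close> make the sum of the floors exceed 2 (m - 1), hence at least 2 m - 1.
  Strictness survives because m - 1 > 0.\<close>

lemma expected_dim_nonneg:
  assumes "m \<ge> 2"
  shows   "0 \<le> 1 - 2 * int m + (\<Sum>i=1..r. elliptic_floor m (e i))"
proof -
  have "2 * (real m - 1) < (real m - 1) * (\<Sum>i=1..r. 1 - 1 / real (e i))"
    using mult_strict_left_mono[OF hyperbolic, of "real m - 1"] assms by (simp add: mult.commute)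
  also have "\<dots> = (\<Sum>i=1..r. (real m - 1) * (1 - 1 / real (e i)))"
    by (simp add: sum_distrib_left)
  also have "\<dots> \<le> (\<Sum>i=1..r. real_of_int (elliptic_floor m (e i)))"
  proof (rule sum_mono)
    fix i assume "i \<in> {1..r}"
    hence e: "e i > 0" using e_ge_2[of i] by simp
    have "int m * (int (e i) - 1) < int (e i) * (elliptic_floor m (e i) + 1)"
      by (rule elliptic_floor_bounds(2)[OF e])
    \<comment> \<open>With n = e i and x the floor, strictness between integers gives m (n - 1) + 1
      \<le> n (x + 1); subtracting n leaves the claim.\<close>
    hence "(int m - 1) * (int (e i) - 1) \<le> int (e i) * elliptic_floor m (e i)"
      by (simp add: algebra_simps)
    hence "real_of_int ((int m - 1) * (int (e i) - 1)) \<le> real_of_int (int (e i) * elliptic_floor m (e i))"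
      by (simp only: of_int_le_iff)
    hence "(real m - 1) * (real (e i) - 1) \<le> real (e i) * real_of_int (elliptic_floor m (e i))"
      by simp
    hence "(real m - 1) * (real (e i) - 1) / real (e i) \<le> real_of_int (elliptic_floor m (e i))"
      using e by (simp add: pos_divide_le_eq mult.commute)
    also have "(real m - 1) * (real (e i) - 1) / real (e i) = (real m - 1) * (1 - 1 / real (e i))"
      unfolding times_divide_eq_right[symmetric] diff_divide_distrib using e by simp
    finally show "(real m - 1) * (1 - 1 / real (e i)) \<le> real_of_int (elliptic_floor m (e i))" .
  qed
  finally have "real_of_int (2 * int m - 2) < real_of_int (\<Sum>i=1..r. elliptic_floor m (e i))"
    by simp
  thus ?thesis
    by (simp only: of_int_less_iff)
qed

end

subsection \<open>The basis\<close>

locale form_basis = elliptic_data +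
  fixes m :: nat
  assumes m_ge_2: "m \<ge> 2"
begin

definition form_of_poly :: "complex poly \<Rightarrow> complex \<Rightarrow> complex" where
  "form_of_poly p = on_uhp (meromorphic_form (int m) (\<lambda>n. - elliptic_floor m n) p)"

definition expected_dim :: nat where
  "expected_dim = nat (1 - 2 * int m + (\<Sum>i=1..r. elliptic_floor m (e i)))"

text \<open>By \<open>expected_dim_nonneg\<close> the truncation by \<open>nat\<close> changes
  nothing.\<close>

lemma int_expected_dim: "int expected_dim = 1 - 2 * int m + (\<Sum>i=1..r. elliptic_floor m (e i))"
  using expected_dim_nonneg[OF m_ge_2] by (simp add: expected_dim_def)

abbreviation small :: "complex poly \<Rightarrow> bool" where
  "small p \<equiv> p = 0 \<or> degree p < expected_dim"

text \<open>At finite points the floors alone ensure holomorphy, since root multiplicities are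
  nonnegative; at poles the condition amounts to the bound on the degree.\<close>

lemma small_extends:
  assumes "small p"
  defines "f \<equiv> meromorphic_form (int m) (\<lambda>n. - elliptic_floor m n) p"
  shows   "remove_sings f analytic_on uhp"
    and   "z \<in> uhp \<Longrightarrow> \<forall>\<^sub>F w in at z. f w = remove_sings f w"
proof -
  have "remove_sings f analytic_on uhp \<and> (\<forall>z\<in>uhp. \<forall>\<^sub>F w in at z. f w = remove_sings f w)"
  proof (cases "p = 0")
    case True
    hence "f = (\<lambda>_. 0)"
      by (simp add: f_def meromorphic_form_def fun_eq_iff)
    moreover have "remove_sings (\<lambda>_. 0) = (\<lambda>_. 0)"
      by (rule ext) (rule remove_sings_at_analytic, rule analytic_on_const)
    ultimately show ?thesis
      by simp
  next
    case False
    have fin: "int m * (int (stabilizer_order \<Gamma> z) - 1) + int (stabilizer_order \<Gamma> z) *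
        (int (Polynomial.order (t z) p) + - elliptic_floor m (stabilizer_order \<Gamma> z)) \<ge> 0"
      if "z \<in> uhp" for z
      by (subst minus_elliptic_floor_le_iff[symmetric]) (use stabilizer_order_pos[OF that] in simp_all)
    have pole: "- int m * (int (stabilizer_order \<Gamma> z) + 1) - int (stabilizer_order \<Gamma> z) *
        (int (degree p) + (\<Sum>i=1..r. - elliptic_floor m (e i)) - - elliptic_floor m (stabilizer_order \<Gamma> z)) \<ge> 0"
      if "z \<in> uhp" for z
    proof -
      define n where "n = stabilizer_order \<Gamma> z"
      define S where "S = (\<Sum>i=1..r. elliptic_floor m (e i))"
      have n: "n > 0" using stabilizer_order_pos[OF that] by (simp add: n_def)
      have "int (degree p) \<le> S - 2 * int m"
        using assms(1) False int_expected_dim by (simp add: S_def)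
      \<comment> \<open>Prepared for \<open>minus_elliptic_floor_le_iff\<close> with the right-hand
        side as x; the floor at the pole cancels, leaving the bound on the degree.\<close>
      hence "- elliptic_floor m n \<le> S - 2 * int m - int (degree p) - elliptic_floor m n"
        by simp
      hence "0 \<le> int m * (int n - 1) + int n * (S - 2 * int m - int (degree p) - elliptic_floor m n)"
        using minus_elliptic_floor_le_iff[OF n] by blast
      also have "\<dots> = - int m * (int n + 1) - int n * (int (degree p) + - S - - elliptic_floor m n)"
        by (simp add: algebra_simps)
      finally show ?thesis
        by (simp only: n_def S_def sum_negf)
    qed
    show ?thesis
      unfolding f_def
      using meromorphic_form_extends[where p = p and c = "\<lambda>n. - elliptic_floor m n" and M = "int m",
          OF False _ fin pole] elliptic_floor_1
      by simp
  qed
  thus "remove_sings f analytic_on uhp"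
    "z \<in> uhp \<Longrightarrow> \<forall>\<^sub>F w in at z. f w = remove_sings f w"
    by auto
qed

lemma small_analytic_at:
  assumes "small p" "z \<in> uhp"
  shows   "remove_sings (meromorphic_form (int m) (\<lambda>n. - elliptic_floor m n) p) analytic_on {z}"
  using small_extends(1)[OF assms(1)] by (rule analytic_on_subset) (use assms in auto)

lemma form_of_poly_in_forms:
  assumes "small p"
  shows   "form_of_poly p \<in> forms (2 * m) \<Gamma>"
proof -
  let ?f = "remove_sings (meromorphic_form (int m) (\<lambda>n. - elliptic_floor m n) p)"
  have "?f holomorphic_on uhp"
    using small_extends(1)[OF assms] by (rule analytic_imp_holomorphic)
  hence "form_of_poly p holomorphic_on uhp"
    by (rule holomorphic_transform) (simp add: form_of_poly_def on_uhp_def)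
  moreover have "form_of_poly p (act A z) =
      (complex_of_real (A $ 2 $ 1) * z + complex_of_real (A $ 2 $ 2)) ^ (2 * m) * form_of_poly p z"
    if "A \<in> \<Gamma>" "z \<in> uhp" for A z
  proof -
    have "?f (act A z) = automorphy_factor A z powi (2 * int m) * ?f z"
      using small_extends[OF assms] that by (intro on_uhp_transform)
    also have "automorphy_factor A z powi (2 * int m) = automorphy_factor A z ^ (2 * m)"
      using power_int_of_nat[of "automorphy_factor A z" "2 * m"] by simp
    finally show ?thesis
      using that act_mem_uhp[OF that] by (simp add: form_of_poly_def on_uhp_def automorphy_factor_def)
  qed
  ultimately show ?thesis
    by (simp add: forms_def) (simp add: form_of_poly_def on_uhp_def)
qed

text \<open>Smallness provides the analytic extensions of both summands, so that their limits
  add.\<close>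

lemma form_of_poly_add:
  assumes "small p" "small q"
  shows   "form_of_poly (p + q) = form_of_poly p + form_of_poly q"
proof
  fix z
  show "form_of_poly (p + q) z = (form_of_poly p + form_of_poly q) z"
  proof (cases "z \<in> uhp")
    case True
    let ?f = "meromorphic_form (int m) (\<lambda>n. - elliptic_floor m n)"
    have "remove_sings (?f (p + q)) z = remove_sings (?f p) z + remove_sings (?f q) z"
    proof (rule remove_sings_eq_extension)
      show "(\<lambda>z. remove_sings (?f p) z + remove_sings (?f q) z) analytic_on {z}"
        using small_analytic_at True assms by (intro analytic_on_add)
      show "\<forall>\<^sub>F w in at z. ?f (p + q) w = remove_sings (?f p) w + remove_sings (?f q) w"
        using small_extends(2)[OF assms(1) True] small_extends(2)[OF assms(2) True]
      proof eventually_elim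
        case (elim w)
        have "?f (p + q) w = ?f p w + ?f q w"
          by (simp add: meromorphic_form_def algebra_simps)
        thus ?case using elim by simp
      qed
    qed
    thus ?thesis using True by (simp add: form_of_poly_def on_uhp_def)
  qed (simp add: form_of_poly_def on_uhp_def)
qed

lemma form_of_poly_smult:
  assumes "small p"
  shows   "form_of_poly (Polynomial.smult u p) = cscale u (form_of_poly p)"
proof
  fix z
  show "form_of_poly (Polynomial.smult u p) z = cscale u (form_of_poly p) z"
  proof (cases "z \<in> uhp")
    case True
    let ?f = "meromorphic_form (int m) (\<lambda>n. - elliptic_floor m n)"
    have "remove_sings (?f (Polynomial.smult u p)) z = u * remove_sings (?f p) z"
    proof (rule remove_sings_eq_extension)
      show "(\<lambda>z. u * remove_sings (?f p) z) analytic_on {z}"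
        using small_analytic_at True assms by (intro analytic_on_mult analytic_on_const)
      show "\<forall>\<^sub>F w in at z. ?f (Polynomial.smult u p) w = u * remove_sings (?f p) w"
        using small_extends(2)[OF assms(1) True]
      proof eventually_elim
        case (elim w)
        have "?f (Polynomial.smult u p) w = u * ?f p w"
          by (simp add: meromorphic_form_def algebra_simps)
        thus ?case using elim by simp
      qed
    qed
    thus ?thesis using True by (simp add: form_of_poly_def on_uhp_def cscale_def)
  qed (simp add: form_of_poly_def on_uhp_def cscale_def)
qed

text \<open>For p \<noteq> 0 the expression has an order at a finite point, hence is nonzero close
  to it.\<close>

lemma form_of_poly_eq_0:
  assumes "small p" "form_of_poly p = 0"
  shows   "p = 0"
proof (rule ccontr)
  assume p: "p \<noteq> 0"
  let ?f = "meromorphic_form (int m) (\<lambda>n. - elliptic_floor m n) p"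
  obtain z where z: "z \<in> uhp" "sphere_value t z = Some 0"
    by (rule sphere_value_surj)
  have "\<not> is_pole t z"
    using z(2) by (auto simp: sphere_value_def)
  from meromorphic_form_order_finite[where M = "int m" and c = "\<lambda>n. - elliptic_floor m n",
      OF z(1) this p] elliptic_floor_1
  have "\<forall>\<^sub>F w in at z. ?f w \<noteq> 0"
    by (metis has_order_nonzero neg_0_equal_iff_equal)
  moreover have "\<forall>\<^sub>F w in at z. w \<in> uhp"
    using eventually_in_uhp[OF z(1)] by (simp add: eventually_nhds_conv_at)
  ultimately have "\<forall>\<^sub>F w in at z. False"
    using small_extends(2)[OF assms(1) z(1)]
  proof eventually_elim
    case (elim w)
    have "remove_sings ?f w = form_of_poly p w"
      using elim(2) by (simp add: form_of_poly_def on_uhp_def)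
    also have "\<dots> = 0"
      using assms(2) by simp
    finally show ?case using elim by simp
  qed
  thus False by simp
qed

text \<open>f and the m-th power of t' have the same weight, so G is invariant. Passing to
  \<open>remove_sings G\<close> supplies the normalized values that membership in
  \<open>modular_functions\<close> demands.\<close>

lemma form_is_rational:
  assumes "f \<in> forms (2 * m) \<Gamma>"
  obtains P Q where "Q \<noteq> 0"
    "\<forall>z\<in>uhp. \<forall>\<^sub>F w in at z. f w = deriv t w ^ m * (poly P (t w) / poly Q (t w))"
proof -
  have f: "f holomorphic_on uhp"
    "\<And>A z. A \<in> \<Gamma> \<Longrightarrow> z \<in> uhp \<Longrightarrow> f (act A z) = automorphy_factor A z ^ (2 * m) * f z"
    using assms by (auto simp: forms_def automorphy_factor_def)
  define G where "G = (\<lambda>z. f z / deriv t z ^ m)"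
  have "f meromorphic_on uhp"
    using f(1) open_uhp by (intro analytic_on_imp_meromorphic_on) (simp add: analytic_on_open)
  hence G: "G meromorphic_on uhp"
    unfolding G_def using t_meromorphic
    by (intro meromorphic_on_divide meromorphic_on_power meromorphic_on_deriv)
  have "remove_sings G \<in> modular_functions \<Gamma>"
    unfolding modular_functions_def
  proof (intro CollectI conjI ballI)
    show "remove_sings G nicely_meromorphic_on uhp"
      using G by (rule remove_sings_nicely_meromorphic)
    fix A z assume A: "A \<in> \<Gamma>" and z: "z \<in> uhp"
    have "\<forall>\<^sub>F w in at z. G (act A w) = G w"
      using eventually_analytic[OF z]
        eventually_at_act[OF det_1[OF A] z eventually_analytic[OF act_mem_uhp[OF A z]]]
    proof eventually_elim
      case (elim w)
      have j: "automorphy_factor A w \<noteq> 0"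
        using elim by (intro automorphy_factor_nonzero det_1[OF A]) simp
      have "G (act A w) = automorphy_factor A w ^ (2 * m) * f w /
              (automorphy_factor A w ^ (2 * m) * deriv t w ^ m)"
      proof -
        have "f (act A w) = automorphy_factor A w ^ (2 * m) * f w"
          using elim by (intro f(2)[OF A]) simp
        moreover have "deriv t (act A w) = automorphy_factor A w ^ 2 * deriv t w"
          using elim by (intro deriv_t_act[OF A]) simp_all
        ultimately show ?thesis
          unfolding G_def by (simp only: power_mult_distrib power_mult)
      qed
      also have "\<dots> = G w"
        using j by (simp add: G_def)
      finally show ?case .
    qed
    thus "remove_sings G (act A z) = remove_sings G z"
      using A z by (intro remove_sings_invariant)
  qed
  moreover have "\<forall>f\<in>modular_functions \<Gamma>. \<exists>p q :: complex poly. q \<noteq> 0 \<and>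
      (\<forall>\<^sub>\<approx>z\<in>uhp. f z = poly p (t z) / poly q (t z))"
    using hauptmodul unfolding hauptmodul_def by (elim conjE)
  ultimately have "\<exists>p q :: complex poly. q \<noteq> 0 \<and>
      (\<forall>\<^sub>\<approx>z\<in>uhp. remove_sings G z = poly p (t z) / poly q (t z))"
    by (rule bspec[rotated])
  then obtain P Q :: "complex poly" where PQ: "Q \<noteq> 0"
    "\<forall>\<^sub>\<approx>z\<in>uhp. remove_sings G z = poly P (t z) / poly Q (t z)"
    by (elim exE conjE)
  have "\<forall>\<^sub>F w in at z. f w = deriv t w ^ m * (poly P (t w) / poly Q (t w))" if z: "z \<in> uhp" for z
  proof -
    have "\<forall>\<^sub>F w in at z. deriv t w \<noteq> 0"
      by (cases "is_pole t z")
         (rule has_order_nonzero[OF order_deriv_pole[OF z]] has_order_nonzero[OF order_deriv_finite[OF z]],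
          assumption)+
    moreover have "\<forall>\<^sub>F w in at z. remove_sings G w = G w"
      using eventually_cosparse_imp_eventually_at[OF eventually_remove_sings_eq[OF G] z] .
    ultimately show ?thesis
      using eventually_cosparse_imp_eventually_at[OF PQ(2) z]
    proof eventually_elim
      case (elim w)
      thus ?case
        by (simp add: G_def nonzero_divide_eq_eq mult.commute)
    qed
  qed
  hence "\<forall>z\<in>uhp. \<forall>\<^sub>F w in at z. f w = deriv t w ^ m * (poly P (t w) / poly Q (t w))"
    by (rule ballI)
  with PQ(1) show ?thesis by (rule that)
qed

text \<open>Holomorphy of f bounds the multiplicities of P/Q below by minus the floors, so
  multiplication by R clears the denominator. The order at a point over infinity then bounds the
  degree of the resulting polynomial.\<close>

lemma forms_subset_range:
  assumes "f \<in> forms (2 * m) \<Gamma>"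
  obtains p where "small p" "form_of_poly p = f"
proof (cases "f = 0")
  case True
  have "form_of_poly 0 = cscale 0 (form_of_poly 0)"
    using form_of_poly_smult[of 0 0] by simp
  hence "form_of_poly 0 = 0"
    by (simp add: cscale_def fun_eq_iff)
  thus ?thesis using that[of 0] True by simp
next
  case False
  have hol: "f holomorphic_on uhp" and outside: "\<And>z. z \<notin> uhp \<Longrightarrow> f z = 0"
    using assms by (auto simp: forms_def)
  have anl: "f analytic_on {z}" if "z \<in> uhp" for z
    using hol open_uhp that by (simp add: holomorphic_on_imp_analytic_at)
  obtain P Q where Q: "Q \<noteq> 0" and rational:
    "\<forall>z\<in>uhp. \<forall>\<^sub>F w in at z. f w = deriv t w ^ m * (poly P (t w) / poly Q (t w))"
    using form_is_rational[OF assms] .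
  note f_eq = bspec[OF rational]
  have P: "P \<noteq> 0"
  proof
    assume "P = 0"
    have "f z = 0" for z
    proof (cases "z \<in> uhp")
      case True
      have "\<forall>\<^sub>F w in at z. f w = (\<lambda>_. 0) w"
        using f_eq[OF True] by eventually_elim (simp add: \<open>P = 0\<close>)
      from analytic_eq_of_eventually_eq[OF anl[OF True] analytic_on_const this] show ?thesis .
    qed (rule outside)
    with False show False by (auto simp: fun_eq_iff)
  qed
  have nonneg: "n \<ge> 0" if "z \<in> uhp"
    "has_order (\<lambda>w. deriv t w ^ m * (poly P (t w) / poly Q (t w))) z n" for z n
  proof -
    have "\<forall>\<^sub>F w in at z. deriv t w ^ m * (poly P (t w) / poly Q (t w)) = f w"
      using f_eq[OF that(1)] by eventually_elim (rule sym)
    with that(2) have "has_order f z n"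
      by (rule has_order_cong)
    thus ?thesis
      by (rule has_order_not_pole_imp_nonneg[OF _ analytic_at_imp_no_pole[OF anl[OF that(1)]]])
  qed
  have fin: "int (Polynomial.order (t z) Q) \<le>
      int (Polynomial.order (t z) P) + elliptic_floor m (stabilizer_order \<Gamma> z)"
    if z: "z \<in> uhp" "\<not> is_pole t z" for z
  proof -
    define n where "n = stabilizer_order \<Gamma> z"
    have "0 \<le> int m * (int n - 1) +
            (int n * int (Polynomial.order (t z) P) - int n * int (Polynomial.order (t z) Q))"
      unfolding n_def
      by (rule nonneg[OF z(1) has_order_mult[OF has_order_power[OF order_deriv_finite[OF z]]
            has_order_divide[OF order_poly_finite[OF z P] order_poly_finite[OF z Q]]]])
    hence "0 \<le> int m * (int n - 1) +
            int n * (int (Polynomial.order (t z) P) - int (Polynomial.order (t z) Q))"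
      by (simp only: right_diff_distrib)
    hence "- elliptic_floor m n \<le> int (Polynomial.order (t z) P) - int (Polynomial.order (t z) Q)"
      using minus_elliptic_floor_le_iff stabilizer_order_pos[OF z(1)] by (simp only: n_def)
    thus ?thesis by (simp add: n_def)
  qed
  have pole: "int (degree P) - int (degree Q) \<le> elliptic_floor m (stabilizer_order \<Gamma> z) - 2 * int m"
    if z: "z \<in> uhp" "is_pole t z" for z
  proof -
    define n where "n = stabilizer_order \<Gamma> z"
    have "0 \<le> int m * (- int n - 1) +
            (- int n * int (degree P) - - int n * int (degree Q))"
      unfolding n_def
      by (rule nonneg[OF z(1) has_order_mult[OF has_order_power[OF order_deriv_pole[OF z]]
            has_order_divide[OF order_poly_pole[OF z P] order_poly_pole[OF z Q]]]])
    hence "0 \<le> int m * (int n - 1) + int n * (int (degree Q) - int (degree P) - 2 * int m)"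
      by (simp add: algebra_simps)
    hence "- elliptic_floor m n \<le> int (degree Q) - int (degree P) - 2 * int m"
      using minus_elliptic_floor_le_iff stabilizer_order_pos[OF z(1)] by (simp only: n_def)
    thus ?thesis by (simp add: n_def)
  qed
  \<comment> \<open>R(t) is the reciprocal of the product in the basis functions; \<open>nat\<close>
    is harmless by \<open>elliptic_floor_nonneg\<close>.\<close>
  define R where "R = (\<Prod>i\<in>finite_indices. [:- the (a i), 1:] ^ nat (elliptic_floor m (e i)))"
  have R: "R \<noteq> 0"
    by (simp add: R_def)
  have order_R: "int (Polynomial.order (t z) R) = elliptic_floor m (stabilizer_order \<Gamma> z)"
    if z: "z \<in> uhp" "\<not> is_pole t z" for z
  proof -
    \<comment> \<open>The case M = 0 of the general order formula; comparison with
      \<open>order_poly_finite\<close> and division by the stabilizer order give the multiplicity of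
      the root t z.\<close>
    have "has_order (\<lambda>w. \<Prod>i\<in>finite_indices. (t w - the (a i)) powi elliptic_floor m (e i)) z
            (int (stabilizer_order \<Gamma> z) * elliptic_floor m (stabilizer_order \<Gamma> z))"
      using meromorphic_form_order_finite[where M = 0 and p = 1 and c = "elliptic_floor m",
          OF z one_neq_zero elliptic_floor_1]
      by (simp add: meromorphic_form_def[abs_def])
    moreover have "(\<Prod>i\<in>finite_indices. (t w - the (a i)) powi elliptic_floor m (e i)) = poly R (t w)" for w
      by (simp add: R_def poly_prod poly_power power_int_def elliptic_floor_nonneg)
    ultimately have "has_order (\<lambda>w. poly R (t w)) z
            (int (stabilizer_order \<Gamma> z) * elliptic_floor m (stabilizer_order \<Gamma> z))"
      by simp
    from has_order_unique[OF this order_poly_finite[OF z R]] show ?thesis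
      using stabilizer_order_pos[OF z(1)] by simp
  qed
  have degree_R: "int (degree R) =
      (\<Sum>i=1..r. elliptic_floor m (e i)) - elliptic_floor m (stabilizer_order \<Gamma> z)"
    if z: "z \<in> uhp" "is_pole t z" for z
  proof -
    have "degree R = (\<Sum>i\<in>finite_indices. nat (elliptic_floor m (e i)))"
      unfolding R_def by (subst degree_prod_eq_sum_degree) (simp_all add: degree_linear_power)
    hence "int (degree R) = (\<Sum>i\<in>finite_indices. elliptic_floor m (e i))"
      by (simp add: elliptic_floor_nonneg)
    also have "\<dots> = (\<Sum>i=1..r. elliptic_floor m (e i)) - elliptic_floor m (stabilizer_order \<Gamma> z)"
      using z elliptic_floor_1 by (rule sum_finite_indices_eq)
    finally show ?thesis .
  qed
  have "Q dvd P * R"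
  proof (rule complex_poly_dvd_of_order_le)
    fix x
    \<comment> \<open>Every x is a value of t, so inequalities at points of the half-plane control
      all multiplicities.\<close>
    obtain z where z: "z \<in> uhp" "sphere_value t z = Some x"
      by (rule sphere_value_surj)
    hence np: "\<not> is_pole t z" and x: "t z = x"
      by (auto simp: sphere_value_def split: if_splits)
    have "Polynomial.order x (P * R) = Polynomial.order x P + Polynomial.order x R"
      using P R by (simp add: order_mult)
    thus "Polynomial.order x Q \<le> Polynomial.order x (P * R)"
      using fin[OF z(1) np] order_R[OF z(1) np] unfolding x by linarith
  qed (use P Q R in auto)
  then obtain p where p: "P * R = Q * p" ..
  hence "p \<noteq> 0" using P R by auto
  \<comment> \<open>The floor at the pole enters the bound for degree P - degree Q with a plus sign
    and degree R with a minus sign, so it drops out of the bound for p.\<close>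
  have "degree P + degree R = degree Q + degree p"
    using arg_cong[OF p, of degree] P Q R \<open>p \<noteq> 0\<close> by (simp add: degree_mult_eq)
  moreover obtain z0 where z0: "z0 \<in> uhp" "sphere_value t z0 = None"
    by (rule sphere_value_surj)
  hence "is_pole t z0"
    by (auto simp: sphere_value_def split: if_splits)
  ultimately have "degree p < expected_dim"
    using pole[OF z0(1)] degree_R[OF z0(1)] int_expected_dim by linarith
  moreover have "form_of_poly p z = f z" for z
  proof (cases "z \<in> uhp")
    case True
    let ?f = "meromorphic_form (int m) (\<lambda>n. - elliptic_floor m n) p"
    have "\<forall>\<^sub>F w in at z. poly q (t w) \<noteq> 0" if "q \<noteq> 0" for q
      by (cases "is_pole t z")
         (rule has_order_nonzero[OF order_poly_pole[OF True _ that]]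
            has_order_nonzero[OF order_poly_finite[OF True _ that]], assumption)+
    from f_eq[OF True] this[OF Q] this[OF R]
    have "\<forall>\<^sub>F w in at z. ?f w = f w"
    proof eventually_elim
      case (elim w)
      have pw: "poly P (t w) * poly R (t w) = poly Q (t w) * poly p (t w)"
        using arg_cong[OF p, of "\<lambda>q. poly q (t w)"] by simp
      have "(\<Prod>i\<in>finite_indices. (t w - the (a i)) powi - elliptic_floor m (e i)) =
              inverse (\<Prod>i\<in>finite_indices. (t w - the (a i)) powi elliptic_floor m (e i))"
        by (simp add: power_int_minus prod_inversef[symmetric] o_def)
      also have "(\<Prod>i\<in>finite_indices. (t w - the (a i)) powi elliptic_floor m (e i)) = poly R (t w)"
        by (simp add: R_def poly_prod poly_power power_int_def elliptic_floor_nonneg)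
      finally have "?f w = deriv t w ^ m * (poly p (t w) / poly R (t w))"
        by (simp add: meromorphic_form_def divide_inverse)
      also have "poly p (t w) / poly R (t w) = poly P (t w) / poly Q (t w)"
        using pw elim(2,3) by (simp add: field_simps)
      finally show ?case using elim(1) by simp
    qed
    from remove_sings_eq_extension[OF anl[OF True] this] show ?thesis
      using True by (simp add: form_of_poly_def on_uhp_def)
  qed (simp add: form_of_poly_def on_uhp_def outside)
  ultimately show ?thesis
    using that[of p] by blast
qed

section \<open>Linear independence, span and dimension\<close>

definition basis_form :: "nat \<Rightarrow> complex \<Rightarrow> complex" where
  "basis_form j = form_of_poly (Polynomial.monom 1 j)"

text \<open>Smallness is carried through the induction because \<open>form_of_poly_add\<close> is
  available only for small polynomials.\<close>

lemma basis_form_combination: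
  assumes "n \<le> expected_dim"
  shows   "form_of_poly (\<Sum>j<n. Polynomial.monom (u j) j) = (\<Sum>j<n. cscale (u j) (basis_form j)) \<and>
           small (\<Sum>j<n. Polynomial.monom (u j) j)"
  using assms
proof (induction n)
  case 0
  have "form_of_poly 0 = cscale 0 (form_of_poly 0)"
    using form_of_poly_smult[of 0 0] by simp
  thus ?case
    by (simp add: cscale_def fun_eq_iff)
next
  case (Suc n)
  let ?s = "\<Sum>j<n. Polynomial.monom (u j) j"
  have small1: "small (Polynomial.monom 1 n)"
    using Suc.prems by (simp add: degree_monom_eq)
  have small2: "small (Polynomial.monom (u n) n)"
    using Suc.prems degree_monom_le[of "u n" n] by simp
  have small3: "small ?s" and IH: "form_of_poly ?s = (\<Sum>j<n. cscale (u j) (basis_form j))"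
    using Suc by auto
  have "form_of_poly (?s + Polynomial.monom (u n) n) = form_of_poly ?s + form_of_poly (Polynomial.smult (u n) (Polynomial.monom 1 n))"
    using form_of_poly_add[OF small3 small2] by (simp add: smult_monom)
  also have "\<dots> = (\<Sum>j<Suc n. cscale (u j) (basis_form j))"
    using form_of_poly_smult[OF small1] IH by (simp add: basis_form_def)
  finally have "form_of_poly (\<Sum>j<Suc n. Polynomial.monom (u j) j) = (\<Sum>j<Suc n. cscale (u j) (basis_form j))"
    by simp
  moreover have "degree (?s + Polynomial.monom (u n) n) < expected_dim"
    using small2 small3 Suc.prems by (intro degree_add_less) auto
  ultimately show ?case
    by simp
qed

lemma coeff_sum_monom: "Polynomial.coeff (\<Sum>j<n. Polynomial.monom (u j) j) i = (if i < n then u i else (0 :: complex))"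
  by (simp add: coeff_sum)

lemma basis_form_linear_independent:
  assumes "(\<Sum>j<expected_dim. cscale (u j) (basis_form j)) = 0" "i < expected_dim"
  shows   "u i = 0"
proof -
  have "(\<Sum>j<expected_dim. Polynomial.monom (u j) j) = 0"
    using basis_form_combination[of expected_dim u] assms(1) form_of_poly_eq_0 by auto
  thus ?thesis
    using coeff_sum_monom[of u expected_dim i] assms(2) by simp
qed

lemma subspace_forms: "cfun.subspace (forms k \<Gamma>)"
proof -
  have "0 holomorphic_on uhp"
    unfolding zero_fun_def by (rule holomorphic_on_const)
  moreover have "f + g holomorphic_on uhp" if "f holomorphic_on uhp" "g holomorphic_on uhp"
    for f g :: "complex \<Rightarrow> complex"
    unfolding plus_fun_def using that by (rule holomorphic_on_add)
  moreover have "cscale u f holomorphic_on uhp" if "f holomorphic_on uhp" for u f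
    unfolding cscale_def using that by (intro holomorphic_on_mult holomorphic_on_const)
  ultimately show ?thesis
    unfolding cfun.subspace_def forms_def by (simp add: cscale_def distrib_left)
qed

text \<open>Injectivity is recorded separately, since independence of an image set does not detect
  repeated members of the family.\<close>

lemma basis_form_is_basis:
  shows "inj_on basis_form {..<expected_dim}"
    and "cfun.independent (basis_form ` {..<expected_dim})"
    and "cfun.span (basis_form ` {..<expected_dim}) = forms (2 * m) \<Gamma>"
    and "cfun.dim (forms (2 * m) \<Gamma>) = expected_dim"
proof -
  let ?B = "basis_form ` {..<expected_dim}"
  show inj: "inj_on basis_form {..<expected_dim}"
  proof (rule inj_onI, rule ccontr)
    fix i j assume ij: "i \<in> {..<expected_dim}" "j \<in> {..<expected_dim}"
      "basis_form i = basis_form j" "i \<noteq> j"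
    define u :: "nat \<Rightarrow> complex" where "u = (\<lambda>l. if l = i then 1 else if l = j then -1 else 0)"
    have "(\<Sum>l<expected_dim. cscale (u l) (basis_form l)) = (\<Sum>l\<in>{i, j}. cscale (u l) (basis_form l))"
      using ij by (intro sum.mono_neutral_right) (auto simp: u_def cscale_def fun_eq_iff)
    also have "\<dots> = 0"
      using ij(3,4) by (simp add: u_def cscale_def fun_eq_iff)
    finally have "u i = 0"
      using basis_form_linear_independent ij(1) by blast
    thus False by (simp add: u_def)
  qed
  show indep: "cfun.independent ?B"
  proof (rule cfun.independent_if_scalars_zero)
    fix f x assume *: "(\<Sum>x\<in>?B. cscale (f x) x) = 0" "x \<in> ?B"
    have "(\<Sum>j<expected_dim. cscale (f (basis_form j)) (basis_form j)) = 0"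
      using *(1) by (simp add: sum.reindex[OF inj] o_def)
    from basis_form_linear_independent[OF this] show "f x = 0"
      using *(2) by auto
  qed auto
  show span: "cfun.span ?B = forms (2 * m) \<Gamma>"
  proof
    show "cfun.span ?B \<subseteq> forms (2 * m) \<Gamma>"
    proof (rule cfun.span_minimal[OF _ subspace_forms])
      show "?B \<subseteq> forms (2 * m) \<Gamma>"
        using form_of_poly_in_forms by (auto simp: basis_form_def degree_monom_eq)
    qed
    show "forms (2 * m) \<Gamma> \<subseteq> cfun.span ?B"
    proof
      fix f assume "f \<in> forms (2 * m) \<Gamma>"
      then obtain p where p: "small p" "form_of_poly p = f"
        by (rule forms_subset_range)
      have "p = (\<Sum>j<expected_dim. Polynomial.monom (Polynomial.coeff p j) j)"
        using p(1) by (intro poly_eqI) (auto simp: coeff_sum_monom coeff_eq_0)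
      hence "f = (\<Sum>j<expected_dim. cscale (Polynomial.coeff p j) (basis_form j))"
        using basis_form_combination[of expected_dim "Polynomial.coeff p"] p(2) by simp
      also have "\<dots> \<in> cfun.span ?B"
        by (intro cfun.span_sum cfun.span_scale cfun.span_base imageI)
      finally show "f \<in> cfun.span ?B" .
    qed
  qed
  have "cfun.span ?B = cfun.span (forms (2 * m) \<Gamma>)"
    using span cfun.span_eq_iff subspace_forms by metis
  hence "cfun.dim (forms (2 * m) \<Gamma>) = card ?B"
    using indep by (rule cfun.dim_eq_card)
  thus "cfun.dim (forms (2 * m) \<Gamma>) = expected_dim"
    using inj by (simp add: card_image)
qed

end

theorem theorem4:
  fixes \<Gamma> :: "(real^2^2) set" and r k :: nat
    and \<tau> :: "nat \<Rightarrow> complex" and e :: "nat \<Rightarrow> nat"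
    and t :: "complex \<Rightarrow> complex" and a :: "nat \<Rightarrow> complex option"
  assumes "shimura_group \<Gamma>" and "genus_zero \<Gamma>"
    and "elliptic_representatives \<Gamma> r \<tau> e"
    and "hauptmodul \<Gamma> t"
    and "\<And>i. i \<in> {1..r} \<Longrightarrow> a i = sphere_value t (\<tau> i)"
    and "even k" and "k \<ge> 4"
  defines "d \<equiv> cfun.dim (forms k \<Gamma>)"
    and "b \<equiv> \<lambda>j. on_uhp (\<lambda>z. deriv t z ^ (k div 2) * t z ^ j *
                (\<Prod>i | i \<in> {1..r} \<and> a i \<noteq> None.
                   (t z - the (a i)) powi (- \<lfloor>real k * (1 - 1 / real (e i)) / 2\<rfloor>)))"
  shows "int d = 1 - int k + (\<Sum>i=1..r. \<lfloor>real k / 2 * (1 - 1 / real (e i))\<rfloor>) \<and>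
         inj_on b {..<d} \<and> cfun.independent (b ` {..<d}) \<and> cfun.span (b ` {..<d}) = forms k \<Gamma>"
proof -
  obtain m where k: "k = 2 * m"
    using assms(6) by (elim evenE)
  have "subgroup \<Gamma> SL2R"
    using assms(1) by (simp add: shimura_group_def)
  moreover have "m \<ge> 2"
    using assms(7) k by simp
  ultimately interpret form_basis \<Gamma> t r \<tau> e a m
    using assms(3-5)
    by (intro form_basis.intro form_basis_axioms.intro elliptic_data.intro elliptic_data_axioms.intro
          hauptmodul_curve.intro hauptmodul_curve_axioms.intro SL2_subgroup.intro)
  \<comment> \<open>The statement writes the argument of the floor in two ways; both equal m (1 -
    1/e i).\<close>
  have floor1: "\<lfloor>real k / 2 * (1 - 1 / real (e i))\<rfloor> = elliptic_floor m (e i)"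
    if "i \<in> {1..r}" for i
    using floor_eq_elliptic_floor[of "e i" m] e_ge_2[OF that] by (simp add: k)
  have floor2: "\<lfloor>real k * (1 - 1 / real (e i)) / 2\<rfloor> = elliptic_floor m (e i)"
    if "i \<in> {1..r}" for i
    using floor1[OF that] by simp
  have d: "d = expected_dim"
    unfolding d_def k by (rule basis_form_is_basis(4))
  have b: "b = basis_form"
  proof
    fix j
    have "(\<Prod>i | i \<in> {1..r} \<and> a i \<noteq> None.
              (t z - the (a i)) powi (- \<lfloor>real k * (1 - 1 / real (e i)) / 2\<rfloor>)) =
          (\<Prod>i\<in>finite_indices. (t z - the (a i)) powi (- elliptic_floor m (e i)))" for z
      unfolding finite_indices_def by (rule prod.cong[OF refl]) (use floor2 in auto)
    thus "b j = basis_form j"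
      unfolding b_def basis_form_def form_of_poly_def meromorphic_form_def[abs_def]
      by (simp only: k) (simp add: poly_monom)
  qed
  have "(\<Sum>i=1..r. \<lfloor>real k / 2 * (1 - 1 / real (e i))\<rfloor>) = (\<Sum>i=1..r. elliptic_floor m (e i))"
    by (rule sum.cong[OF refl]) (rule floor1)
  hence "int d = 1 - int k + (\<Sum>i=1..r. \<lfloor>real k / 2 * (1 - 1 / real (e i))\<rfloor>)"
    unfolding d int_expected_dim by (simp add: k)
  thus ?thesis
    using basis_form_is_basis(1-3) by (simp only: d b k) blast
qed

end
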